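(* Temporal $\Delta$ Independent Set on temporal unit interval graphs $\mathcal{G}=(V,\mathcal{E},\tau)$ can be approximated within a factor of $(\tau-\Delta+1)\cdot 2^{\Delta}$ in linear time.
   Context: A temporal graph $\mathcal{G}=(V,\mathcal{E},\tau)$ consists of a finite vertex set $V$, a lifetime $\tau\in\mathbb{N}$ and a set of time-edges $\mathcal{E}\subseteq\binom{V}{2}\times\{1,\dots,\tau\}$. Its $t$-th layer is the static graph $G_t=(V,E_t)$ with $E_t=\{\{u,v\}:(\{u,v\},t)\in\mathcal{E}\}$. A temporal unit interval graph is a temporal graph each of whose layers is a unit interval graph (intersection graph of intervals of equal length on the real line). Let $1\le\Delta\le\tau$ be an integer. The $\Delta$-conflict graph of $\mathcal{G}$ is the static graph $\bigl(V,\bigcup_{i=1}^{\tau-\Delta+1}\bigcap_{j=i}^{i+\Delta-1}E_j\bigr)$. The optimization version of Temporal $\Delta$ Independent Set asks, given $\mathcal{G}$, for a maximum-size set $V'\subseteq V$ that is an independent set in the $\Delta$-conflict graph of $\mathcal{G}$. "Approximated within a factor of $\alpha$ in linear time" means that there is an algorithm, running in time linear in the input size, that always outputs an independent set of the $\Delta$-conflict graph of size at least $\mathrm{opt}/\alpha$, where $\mathrm{opt}$ is the maximum size of such a set. *)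

theory Defs
  imports Complex_Main
begin

section \<open>Temporal graphs and the conflict graph\<close>

record 'a temporal_graph =
  verts :: "'a set"
  tedges :: "('a set \<times> nat) set"
  lifetime :: nat

definition temporal_graph :: "'a temporal_graph \<Rightarrow> bool" where
  "temporal_graph G \<longleftrightarrow>
     finite (verts G) \<and>
     tedges G \<subseteq> {e. e \<subseteq> verts G \<and> card e = 2} \<times> {1..lifetime G}"

definition layer :: "'a temporal_graph \<Rightarrow> nat \<Rightarrow> 'a set set" where
  "layer G t = {e. (e, t) \<in> tedges G}"

definition unit_interval_graph :: "'a set \<Rightarrow> 'a set set \<Rightarrow> bool" where
  "unit_interval_graph V E \<longleftrightarrow>
     E \<subseteq> {e. e \<subseteq> V \<and> card e = 2} \<and>
     (\<exists>(l::real) (f::'a \<Rightarrow> real). 0 < l \<and>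
        (\<forall>u\<in>V. \<forall>v\<in>V. u \<noteq> v \<longrightarrow>
           ({u, v} \<in> E \<longleftrightarrow> {f u..f u + l} \<inter> {f v..f v + l} \<noteq> {})))"

definition temporal_unit_interval_graph :: "'a temporal_graph \<Rightarrow> bool" where
  "temporal_unit_interval_graph G \<longleftrightarrow>
     temporal_graph G \<and> (\<forall>t\<in>{1..lifetime G}. unit_interval_graph (verts G) (layer G t))"

definition conflict_edges :: "'a temporal_graph \<Rightarrow> nat \<Rightarrow> 'a set set" where
  "conflict_edges G \<Delta> =
     (\<Union>i\<in>{1..lifetime G - \<Delta> + 1}. \<Inter>j\<in>{i..i + \<Delta> - 1}. layer G j)"

definition independent_set :: "'a set \<Rightarrow> 'a set set \<Rightarrow> 'a set \<Rightarrow> bool" where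
  "independent_set V E S \<longleftrightarrow> S \<subseteq> V \<and> (\<forall>u\<in>S. \<forall>v\<in>S. {u, v} \<notin> E)"

definition max_independent :: "'a temporal_graph \<Rightarrow> nat \<Rightarrow> nat" where
  "max_independent G \<Delta> = Max (card ` {S. independent_set (verts G) (conflict_edges G \<Delta>) S})"

section \<open>Random access machines\<close>

text \<open>
  Running time is the number of steps of a unit-cost random access machine.  A machine has
  registers, addressed directly by a program (hence only finitely many are used), and a memory,
  addressed through the contents of registers.  A run ends when the program counter leaves the
  program.  Unit cost is only meaningful for words of bounded length, so the size of all words
  occurring in a run is controlled separately (see \<open>ram_run\<close>).
\<close>

datatype instr =
    Const nat nat      \<comment> \<open>\<open>Const r k\<close>: store \<open>k\<close> in register \<open>r\<close>\<close>
  | Add nat nat nat    \<comment> \<open>target register first\<close>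
  | Sub nat nat nat    \<comment> \<open>truncated at 0\<close>
  | Mul nat nat nat
  | Load nat nat       \<comment> \<open>\<open>Load r a\<close>: the address is the content of register \<open>a\<close>\<close>
  | Store nat nat      \<comment> \<open>\<open>Store a r\<close>: the address is the content of register \<open>a\<close>\<close>
  | Jump nat
  | JumpZero nat nat   \<comment> \<open>\<open>JumpZero r l\<close>: jump to \<open>l\<close> if register \<open>r\<close> contains 0\<close>

record ram_state =
  pc :: nat
  reg :: "nat \<Rightarrow> nat"
  mem :: "nat \<Rightarrow> nat"

fun exec :: "instr \<Rightarrow> ram_state \<Rightarrow> ram_state" where
  "exec (Const r k) s = s\<lparr>pc := pc s + 1, reg := (reg s)(r := k)\<rparr>"
| "exec (Add r a b) s = s\<lparr>pc := pc s + 1, reg := (reg s)(r := reg s a + reg s b)\<rparr>"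
| "exec (Sub r a b) s = s\<lparr>pc := pc s + 1, reg := (reg s)(r := reg s a - reg s b)\<rparr>"
| "exec (Mul r a b) s = s\<lparr>pc := pc s + 1, reg := (reg s)(r := reg s a * reg s b)\<rparr>"
| "exec (Load r a) s = s\<lparr>pc := pc s + 1, reg := (reg s)(r := mem s (reg s a))\<rparr>"
| "exec (Store a r) s = s\<lparr>pc := pc s + 1, mem := (mem s)(reg s a := reg s r)\<rparr>"
| "exec (Jump l) s = s\<lparr>pc := l\<rparr>"
| "exec (JumpZero r l) s = s\<lparr>pc := (if reg s r = 0 then l else pc s + 1)\<rparr>"

definition halted :: "instr list \<Rightarrow> ram_state \<Rightarrow> bool" where
  "halted P s \<longleftrightarrow> length P \<le> pc s"

definition step :: "instr list \<Rightarrow> ram_state \<Rightarrow> ram_state" where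
  "step P s = (if halted P s then s else exec (P ! pc s) s)"

definition init_state :: "nat list \<Rightarrow> ram_state" where
  "init_state w =
     \<lparr>pc = 0, reg = (\<lambda>_. 0), mem = (\<lambda>a. if a < length w then w ! a else 0)\<rparr>"

text \<open>The result is an array: register 0 holds its length, register 1 its start address.\<close>

definition ram_output :: "ram_state \<Rightarrow> nat list" where
  "ram_output s = map (mem s) [reg s 1..<reg s 1 + reg s 0]"

text \<open>
  \<open>ram_run P w T B xs\<close>: on input \<open>w\<close>, the program halts after at most \<open>T\<close> steps with
  result \<open>xs\<close>, and no word exceeds \<open>B\<close> at any time.
\<close>

definition ram_run :: "instr list \<Rightarrow> nat list \<Rightarrow> nat \<Rightarrow> nat \<Rightarrow> nat list \<Rightarrow> bool" where
  "ram_run P w T B xs \<longleftrightarrow>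
     (\<exists>t\<le>T.
        halted P ((step P ^^ t) (init_state w)) \<and>
        ram_output ((step P ^^ t) (init_state w)) = xs \<and>
        (\<forall>i\<le>t. \<forall>a. reg ((step P ^^ i) (init_state w)) a \<le> B \<and>
                   mem ((step P ^^ i) (init_state w)) a \<le> B))"

section \<open>Linear-time approximation\<close>

text \<open>
  A temporal graph is presented by an arbitrary enumeration \<open>vs\<close> of its vertices, which
  become the numbers below \<open>length vs\<close>, and an arbitrary enumeration \<open>es\<close> of its
  time-edges, each listed once, in no particular order and with its two endpoints in either order.
\<close>

definition time_edge_of :: "'a list \<Rightarrow> nat \<times> nat \<times> nat \<Rightarrow> 'a set \<times> nat" where
  "time_edge_of vs = (\<lambda>(i, j, t). ({vs ! i, vs ! j}, t))"

definition presents :: "'a list \<Rightarrow> (nat \<times> nat \<times> nat) list \<Rightarrow> 'a temporal_graph \<Rightarrow> bool" where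
  "presents vs es G \<longleftrightarrow>
     distinct vs \<and> set vs = verts G \<and>
     (\<forall>(i, j, t)\<in>set es. i < length vs \<and> j < length vs) \<and>
     distinct (map (time_edge_of vs) es) \<and> time_edge_of vs ` set es = tedges G"

definition input_words ::
    "'a list \<Rightarrow> (nat \<times> nat \<times> nat) list \<Rightarrow> 'a temporal_graph \<Rightarrow> nat \<Rightarrow> nat list" where
  "input_words vs es G \<Delta> =
     [length vs, lifetime G, \<Delta>, length es] @ concat (map (\<lambda>(i, j, t). [i, j, t]) es)"

text \<open>
  The input size is the number of input words plus the number of vertices, which do not occupy
  words of their own; it is linear in the numbers of vertices and time-edges, and the lifetime
  counts as a single number.  A single program serves all instances, including all values of
  \<open>\<Delta>\<close>.  Words have length logarithmic in the input size and the numbers in the input, that is,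
  they are bounded by a polynomial.
\<close>

definition approximated_in_linear_time ::
    "('a temporal_graph \<Rightarrow> bool) \<Rightarrow> ('a temporal_graph \<Rightarrow> nat \<Rightarrow> real) \<Rightarrow> bool" where
  "approximated_in_linear_time \<C> \<alpha> \<longleftrightarrow>
     (\<exists>P c. \<forall>G \<Delta> vs es.
        \<C> G \<longrightarrow> 1 \<le> \<Delta> \<longrightarrow> \<Delta> \<le> lifetime G \<longrightarrow> presents vs es G \<longrightarrow>
        (let w = input_words vs es G \<Delta>; N = length vs + length w
         in \<exists>xs. ram_run P w (c * N) ((N + Max (set w)) ^ c) xs \<and>
              distinct xs \<and> set xs \<subseteq> {..<length vs} \<and>
              independent_set (verts G) (conflict_edges G \<Delta>) ((!) vs ` set xs) \<and>
              real (card ((!) vs ` set xs)) \<ge> real (max_independent G \<Delta>) / \<alpha> G \<Delta>))"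

end

theory Submission imports Defs
begin

text \<open>
  Any maximal independent set of the conflict graph is good enough: in a unit interval graph the
  neighbourhood of a vertex is covered by two cliques, so in the conflict graph it is covered by
  \<open>(\<tau> - \<Delta> + 1) * 2 ^ \<Delta>\<close> cliques, and each vertex of a maximal independent set is adjacent to at
  most that many vertices of an optimal one.

  Such a set is computed greedily.  The memory is initially zero and word addresses may be
  polynomially large, so tables indexed by pairs of vertices and time steps cost nothing to set up.
  Time-edges arrive in arbitrary order; for each pair the length of every maximal run of
  consecutive time steps is kept at both ends of the run, so that a new time step merges its two
  neighbouring runs in constant time, and the pair is in conflict once a run reaches length
  \<open>\<Delta>\<close>.  Each time-edge then adds at most one entry to two adjacency lists, which bounds the work
  of the greedy phase.
\<close>

section \<open>Maximal independent sets\<close>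

text \<open>The factor \<open>2 ^ \<Delta>\<close> arises layer by layer: neighbours of
  \<open>p\<close> whose intervals start on the same side of that of \<open>p\<close> have left
  endpoints within one interval length of each other, hence form a clique, and a window offers one
  choice of side in each of its \<Delta> layers. Taking the union over windows multiplies by their
  number. The obstacle is the running time. The lifetime is a single input word and can be far
  larger than the number of words, so neither a scan over time steps nor one over all pairs of
  vertices is affordable. All work is therefore charged to time-edges and vertices, and the price is
  paid in address space: addresses are products of three factors below \<open>W\<close>, so words
  grow to about \<open>W * W * W\<close>. The total is at most \<open>63 * m + 14 * n + 16\<close>
  steps, where 18 of the 63 pay for visiting the up to two list entries that a time-edge creates.
  The constant 64 is a generous round bound for this; it serves as exponent of the word bound too,
  because one constant has to do both.\<close>

lemma conflict_edges_subset:
  assumes "temporal_graph G" "1 \<le> \<Delta>" "\<Delta> \<le> lifetime G"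
  shows "conflict_edges G \<Delta> \<subseteq> {e. e \<subseteq> verts G \<and> card e = 2}"
proof
  fix e assume "e \<in> conflict_edges G \<Delta>"
  then obtain i where "e \<in> (\<Inter>j\<in>{i..i + \<Delta> - 1}. layer G j)"
    unfolding conflict_edges_def by blast
  then have "e \<in> layer G i" using assms(2) by auto
  then show "e \<in> {e. e \<subseteq> verts G \<and> card e = 2}"
    using assms(1) unfolding layer_def temporal_graph_def by blast
qed

text \<open>
  The neighbours \<open>u\<close> of \<open>p\<close> witnessed by the window starting at \<open>i\<close> are classified by the
  set of layers of the window in which the interval of \<open>u\<close> does not start to the right of
  that of \<open>p\<close>; two neighbours of the same class are adjacent throughout the window.
\<close>

lemma card_independent_neighbours:
  assumes G: "temporal_unit_interval_graph G" and \<Delta>: "1 \<le> \<Delta>" "\<Delta> \<le> lifetime G"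
    and S: "independent_set (verts G) (conflict_edges G \<Delta>) S" and p: "p \<in> verts G"
  shows "card {u \<in> S. {p, u} \<in> conflict_edges G \<Delta>} \<le> (lifetime G - \<Delta> + 1) * 2 ^ \<Delta>"
proof -
  let ?N = "{u \<in> S. {p, u} \<in> conflict_edges G \<Delta>}"
  have tg: "temporal_graph G" using G unfolding temporal_unit_interval_graph_def by blast
  have "\<forall>t\<in>{1..lifetime G}. \<exists>(l::real) f. 0 < l \<and>
        (\<forall>u\<in>verts G. \<forall>v\<in>verts G. u \<noteq> v \<longrightarrow>
           ({u, v} \<in> layer G t \<longleftrightarrow> {f u..f u + l} \<inter> {f v..f v + l} \<noteq> {}))"
    using G unfolding temporal_unit_interval_graph_def unit_interval_graph_def by blast
  then obtain l :: "nat \<Rightarrow> real" and f :: "nat \<Rightarrow> 'a \<Rightarrow> real" where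
    "\<And>t. t \<in> {1..lifetime G} \<Longrightarrow> 0 < l t \<and>
        (\<forall>u\<in>verts G. \<forall>v\<in>verts G. u \<noteq> v \<longrightarrow>
           ({u, v} \<in> layer G t \<longleftrightarrow> {f t u..f t u + l t} \<inter> {f t v..f t v + l t} \<noteq> {}))"
    by metis
  \<comment> \<open>Intervals of a common length meet exactly if their left endpoints are at most
    that length apart.\<close>
  then have adj: "{u, v} \<in> layer G t \<longleftrightarrow> \<bar>f t u - f t v\<bar> \<le> l t"
    if "t \<in> {1..lifetime G}" "u \<in> verts G" "v \<in> verts G" "u \<noteq> v" for t u v
    using that by (auto simp: abs_le_iff)
  define win where "win i = {i..i + \<Delta> - 1}" for i
  have confl: "e \<in> conflict_edges G \<Delta> \<longleftrightarrow>
      (\<exists>i\<in>{1..lifetime G - \<Delta> + 1}. \<forall>j\<in>win i. e \<in> layer G j)" for e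
    unfolding conflict_edges_def win_def by auto
  have win_sub: "win i \<subseteq> {1..lifetime G}" if "i \<in> {1..lifetime G - \<Delta> + 1}" for i
    using that \<Delta> unfolding win_def by auto
  have SV: "S \<subseteq> verts G" using S unfolding independent_set_def by blast
  have "\<forall>u\<in>?N. \<exists>i. i \<in> {1..lifetime G - \<Delta> + 1} \<and> (\<forall>j\<in>win i. {p, u} \<in> layer G j)"
    using confl by blast
  \<comment> \<open>A neighbour may be witnessed by several windows; an arbitrary one is
    fixed.\<close>
  from bchoice[OF this] obtain w where
    w: "u \<in> ?N \<Longrightarrow> w u \<in> {1..lifetime G - \<Delta> + 1}"
      "u \<in> ?N \<Longrightarrow> j \<in> win (w u) \<Longrightarrow> {p, u} \<in> layer G j" for u j
    by blast
  have neq: "u \<noteq> p" if "u \<in> ?N" for u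
    using that conflict_edges_subset[OF tg \<Delta>] by auto
  define \<phi> where "\<phi> u = (w u, {j \<in> win (w u). f j u \<le> f j p})" for u
  have "inj_on \<phi> ?N"
  proof (rule inj_onI, rule ccontr)
    fix u u' assume u: "u \<in> ?N" "u' \<in> ?N" and eq: "\<phi> u = \<phi> u'" and "u \<noteq> u'"
    have V: "u \<in> verts G" "u' \<in> verts G" using u SV by auto
    have weq: "w u' = w u" using eq unfolding \<phi>_def by auto
    have side: "f j u \<le> f j p \<longleftrightarrow> f j u' \<le> f j p" if "j \<in> win (w u)" for j
    proof -
      have "{j \<in> win (w u). f j u \<le> f j p} = {j \<in> win (w u). f j u' \<le> f j p}"
        using eq unfolding \<phi>_def weq by blast
      then show ?thesis using that by blast
    qed
    have "{u, u'} \<in> layer G j" if j: "j \<in> win (w u)" for j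
    proof -
      have jt: "j \<in> {1..lifetime G}" using win_sub[OF w(1)[OF u(1)]] j by blast
      have "\<bar>f j p - f j u\<bar> \<le> l j" "\<bar>f j p - f j u'\<bar> \<le> l j"
        using adj[OF jt p V(1)] adj[OF jt p V(2)] neq u w(2)[OF u(1) j]
          w(2)[OF u(2), unfolded weq, OF j] by auto
      \<comment> \<open>Both left endpoints lie on the same side of \<open>f j p\<close> and within
        \<open>l j\<close> of it.\<close>
      then have "\<bar>f j u - f j u'\<bar> \<le> l j" using side[OF j] by (auto simp: abs_le_iff)
      then show ?thesis using adj[OF jt V \<open>u \<noteq> u'\<close>] by simp
    qed
    then have "{u, u'} \<in> conflict_edges G \<Delta>" using confl w(1)[OF u(1)] by blast
    then show False using S u unfolding independent_set_def by blast
  qed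
  moreover have "\<phi> ` ?N \<subseteq> (SIGMA i:{1..lifetime G - \<Delta> + 1}. Pow (win i))"
    using w(1) unfolding \<phi>_def by auto
  ultimately have "card ?N \<le> card (SIGMA i:{1..lifetime G - \<Delta> + 1}. Pow (win i))"
    by (intro card_inj_on_le[of \<phi>] finite_SigmaI) (auto simp: win_def)
  \<comment> \<open>One class per window and per subset of its \<Delta> layers.\<close>
  also have "\<dots> = (\<Sum>i\<in>{1..lifetime G - \<Delta> + 1}. 2 ^ \<Delta>)"
    using \<Delta> by (subst card_SigmaI) (auto simp: win_def card_Pow)
  finally show ?thesis by simp
qed

text \<open>A charging argument: by maximality every vertex of an independent \<open>S\<close>
  equals or neighbours some \<open>p\<close> in \<open>I\<close> and is charged to it; no
  \<open>p\<close> receives more than \<open>?K\<close> charges.\<close>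

lemma max_independent_le:
  assumes G: "temporal_unit_interval_graph G" and \<Delta>: "1 \<le> \<Delta>" "\<Delta> \<le> lifetime G"
    and I: "I \<subseteq> verts G"
    and maximal: "\<And>v. v \<in> verts G \<Longrightarrow> v \<in> I \<or> (\<exists>p\<in>I. {p, v} \<in> conflict_edges G \<Delta>)"
  shows "max_independent G \<Delta> \<le> card I * ((lifetime G - \<Delta> + 1) * 2 ^ \<Delta>)"
proof -
  let ?K = "(lifetime G - \<Delta> + 1) * 2 ^ \<Delta>"
  let ?C = "conflict_edges G \<Delta>"
  let ?F = "{S. independent_set (verts G) ?C S}"
  have fin: "finite (verts G)"
    using G unfolding temporal_unit_interval_graph_def temporal_graph_def by blast
  have finF: "finite ?F"
    using fin by (rule finite_subset[rotated, OF finite_Pow_iff[THEN iffD2]])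
      (auto simp: independent_set_def)
  have bound: "card S \<le> card I * ?K" if S: "independent_set (verts G) ?C S" for S
  proof -
    have finS: "finite S" using S fin unfolding independent_set_def by (meson finite_subset)
    have finI: "finite I" using I fin by (meson finite_subset)
    let ?B = "\<lambda>p. {u \<in> S. u = p \<or> {p, u} \<in> ?C}"
    have "S \<subseteq> (\<Union>p\<in>I. ?B p)"
      using maximal S unfolding independent_set_def by blast
    then have "card S \<le> card (\<Union>p\<in>I. ?B p)"
      using finS finI by (intro card_mono) auto
    also have "\<dots> \<le> (\<Sum>p\<in>I. card (?B p))" using finI by (rule card_UN_le)
    also have "\<dots> \<le> (\<Sum>p\<in>I. ?K)"
    proof (rule sum_mono)
      fix p assume pI: "p \<in> I"
      show "card (?B p) \<le> ?K"
      proof (cases "p \<in> S")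
        case True
        \<comment> \<open>If \<open>p\<close> itself lies in \<open>S\<close>, independence of
          \<open>S\<close> leaves \<open>p\<close> as its only charge.\<close>
        then have "?B p \<subseteq> {p}" using S unfolding independent_set_def by blast
        then have "card (?B p) \<le> 1" using card_mono[of "{p}" "?B p"] by simp
        also have "1 \<le> ?K" by (simp add: Suc_le_eq)
        finally show ?thesis .
      next
        case False
        then have "?B p = {u \<in> S. {p, u} \<in> ?C}" by auto
        then show ?thesis using card_independent_neighbours[OF G \<Delta> S] pI I by auto
      qed
    qed
    finally show ?thesis by simp
  qed
  have "independent_set (verts G) ?C {}" unfolding independent_set_def by simp
  then have "Max (card ` ?F) \<in> card ` ?F" using finF by (intro Max_in) auto
  then show ?thesis using bound unfolding max_independent_def by auto
qed

section \<open>Bounded runs and straight-line code\<close>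

definition bounded :: "nat \<Rightarrow> ram_state \<Rightarrow> bool" where
  "bounded B s \<longleftrightarrow> (\<forall>a. reg s a \<le> B \<and> mem s a \<le> B)"

text \<open>Step counts are exact, so they add under composition. The program counter is not a word
  and stays outside the bound.\<close>

definition runs :: "instr list \<Rightarrow> nat \<Rightarrow> nat \<Rightarrow> ram_state \<Rightarrow> ram_state \<Rightarrow> bool" where
  "runs P B k s s' \<longleftrightarrow> (step P ^^ k) s = s' \<and> (\<forall>i\<le>k. bounded B ((step P ^^ i) s))"

lemma runs_bounded: "runs P B k s s' \<Longrightarrow> bounded B s'"
  unfolding runs_def by blast

lemma runs_refl: "bounded B s \<Longrightarrow> runs P B 0 s s"
  unfolding runs_def by simp

lemma runs_trans:
  assumes "runs P B k s s'" "runs P B k' s' s''"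
  shows "runs P B (k + k') s s''"
proof -
  have eq: "(step P ^^ (j + k)) s = (step P ^^ j) s'" for j
    using assms(1) unfolding runs_def by (simp add: funpow_add)
  have "bounded B ((step P ^^ i) s)" if "i \<le> k + k'" for i
  proof (cases "i \<le> k")
    case True
    then show ?thesis using assms(1) unfolding runs_def by blast
  next
    case False
    then have "i = (i - k) + k" "i - k \<le> k'" using that by simp_all
    then obtain j where "i = j + k" "j \<le> k'" by blast
    then show ?thesis using eq assms(2) unfolding runs_def by simp
  qed
  moreover have "(step P ^^ (k + k')) s = s''"
    using eq[of k'] assms(2) unfolding runs_def by (simp add: add.commute)
  ultimately show ?thesis unfolding runs_def by blast
qed

lemma runs_step:
  assumes "bounded B s" "pc s < length P" "P ! pc s = i" "bounded B (exec i s)"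
  shows "runs P B 1 s (exec i s)"
proof -
  have "step P s = exec i s" using assms(2,3) unfolding step_def halted_def by simp
  then show ?thesis using assms(1,4) unfolding runs_def
    by (auto simp: le_Suc_eq)
qed

text \<open>Locating a block by its absolute address allows it to be verified without unfolding the
  rest of the program.\<close>

definition code_at :: "instr list \<Rightarrow> nat \<Rightarrow> instr list \<Rightarrow> bool" where
  "code_at P l is \<longleftrightarrow> l + length is \<le> length P \<and> take (length is) (drop l P) = is"

lemma code_at_Cons:
  assumes "code_at P l (i # is)"
  shows "l < length P" "P ! l = i" "code_at P (l + 1) is"
proof -
  show l: "l < length P" using assms unfolding code_at_def by simp
  have "take (Suc (length is)) (P ! l # drop (l + 1) P) = i # is"
    using assms unfolding code_at_def by (simp add: Cons_nth_drop_Suc l)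
  then show "P ! l = i" "code_at P (l + 1) is"
    using assms unfolding code_at_def by auto
qed

fun straight :: "instr \<Rightarrow> bool" where
  "straight (Jump l) = False"
| "straight (JumpZero r l) = False"
| "straight _ = True"

text \<open>
  The value that must be checked against the word bound; loaded words are already bounded.
\<close>

fun written :: "instr \<Rightarrow> ram_state \<Rightarrow> nat" where
  "written (Const r k) s = k"
| "written (Add r a b) s = reg s a + reg s b"
| "written (Sub r a b) s = reg s a - reg s b"
| "written (Mul r a b) s = reg s a * reg s b"
| "written _ s = 0"

text \<open>On a concrete block this simplifies to finitely many inequalities between register
  expressions, which are all that the word bound requires of straight-line code.\<close>

fun block_ok :: "nat \<Rightarrow> instr list \<Rightarrow> ram_state \<Rightarrow> bool" where
  "block_ok B [] s = True"
| "block_ok B (i # is) s = (written i s \<le> B \<and> block_ok B is (exec i s))"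

lemma bounded_exec: "bounded B s \<Longrightarrow> written i s \<le> B \<Longrightarrow> bounded B (exec i s)"
  by (cases i) (auto simp: bounded_def)

lemma bounded_fold_exec: "bounded B s \<Longrightarrow> block_ok B is s \<Longrightarrow> bounded B (fold exec is s)"
  by (induction "is" arbitrary: s) (auto intro: bounded_exec)

lemma runs_block:
  assumes "code_at P (pc s) is" "\<forall>i\<in>set is. straight i" "block_ok B is s" "bounded B s"
  shows "runs P B (length is) s (fold exec is s)"
  using assms
proof (induction "is" arbitrary: s)
  case Nil
  then show ?case by (simp add: runs_refl)
next
  case (Cons i "is")
  have pc: "pc (exec i s) = pc s + 1" using Cons.prems(2) by (cases i) auto
  have b: "bounded B (exec i s)" using Cons.prems by (auto intro: bounded_exec)
  have one: "runs P B 1 s (exec i s)"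
    by (rule runs_step[OF Cons.prems(4) code_at_Cons(1,2)[OF Cons.prems(1)] b])
  have "runs P B (length is) (exec i s) (fold exec is (exec i s))"
    using Cons.prems(2,3) code_at_Cons(3)[OF Cons.prems(1)] b pc by (intro Cons.IH) simp_all
  from runs_trans[OF one this] show ?case by simp
qed

lemma runs_Jump:
  assumes "code_at P (pc s) [Jump l]" "bounded B s"
  shows "runs P B 1 s (s\<lparr>pc := l\<rparr>)"
proof -
  have "bounded B (exec (Jump l) s)" using assms(2) by (simp add: bounded_def)
  from runs_step[OF assms(2) code_at_Cons(1,2)[OF assms(1)] this] show ?thesis by simp
qed

lemma runs_JumpZero:
  assumes "code_at P (pc s) [JumpZero r l]" "bounded B s"
  shows "runs P B 1 s (s\<lparr>pc := (if reg s r = 0 then l else pc s + 1)\<rparr>)"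
proof -
  have "bounded B (exec (JumpZero r l) s)" using assms(2) by (simp add: bounded_def)
  from runs_step[OF assms(2) code_at_Cons(1,2)[OF assms(1)] this] show ?thesis by simp
qed

section \<open>The program\<close>

text \<open>
  Registers: 0 and 1 describe the output, 2 holds the number of vertices and then the number of
  unprocessed ones, 3 the row width \<open>W\<close> of the memory grid, 4 the window length \<open>\<Delta>\<close>, 5 the number
  of unread time-edges, 6 the input position, 7 and 8 the constants 1 and 2, 9 the product
  \<open>n * W\<close>.  Truncated subtraction replaces branching: \<open>i - (i - j)\<close> is the minimum of \<open>i\<close> and
  \<open>j\<close>, and \<open>1 - (\<Delta> - l)\<close> is 1 if \<open>\<Delta> \<le> l\<close> and 0 otherwise, so that a neighbour is always
  stored but counted only if this flag is 1.
\<close>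

definition setup_code :: "instr list" where
  "setup_code = [Const 7 1, Load 2 1, Load 3 7, Const 8 2, Load 4 8, Const 6 3, Load 5 6,
     Mul 10 6 5, Add 10 10 2, Add 3 3 10, Const 6 6, Add 3 3 6, Const 6 4, Mul 9 2 3]"

text \<open>Registers 14 and 15 first hold the smaller and the larger index; 15 then becomes the
  table address of the pair at the time step. Registers 17 and 18 receive the adjacent run lengths,
  13 and 14 the two ends of the merged run, and 17 finally the flag.\<close>

definition read_code :: "instr list" where
  "read_code = [Load 10 6, Add 6 6 7, Load 11 6, Add 6 6 7, Load 12 6, Add 6 6 7,
     Sub 13 10 11, Sub 14 10 13, Sub 15 11 10, Add 15 10 15,
     Mul 15 15 3, Add 15 15 14, Mul 15 15 3, Add 15 15 12,
     Sub 16 15 7, Load 17 16, Add 16 15 7, Load 18 16,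
     Sub 13 15 17, Add 14 15 18, Add 17 17 18, Add 17 17 7,
     Store 13 17, Store 14 17, Sub 17 4 17, Sub 17 7 17]"

definition append_code :: "nat \<Rightarrow> nat \<Rightarrow> instr list" where
  "append_code x y = [Add 13 9 x, Mul 13 13 3, Load 14 13, Add 15 14 17, Store 13 15,
     Add 14 14 13, Add 14 14 8, Store 14 y]"

definition edge_code :: "instr list" where
  "edge_code = read_code @ append_code 10 11 @ append_code 11 10 @ [Sub 5 5 7]"

text \<open>Again free of branches: the vertex is always written to the next output cell, but a
  blocked one does not advance the output length and has its neighbour count multiplied by 0, so
  nothing is marked for it.\<close>

definition pick_code :: "instr list" where
  "pick_code = [Sub 2 2 7, Add 13 9 2, Mul 13 13 3, Load 14 13, Add 15 13 7, Load 15 15,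
     Sub 15 7 15, Store 0 2, Add 0 0 15, Mul 14 14 15, Add 13 13 8]"

definition mark_code :: "instr list" where
  "mark_code = [Sub 14 14 7, Add 16 13 14, Load 16 16, Add 16 9 16, Mul 16 16 3, Add 16 16 7,
     Store 16 7]"

text \<open>Loop heads are at 14 (time-edges), 59 (vertices) and 71 (marking); 81 is the program
  length, so a jump there halts.\<close>

definition program :: "instr list" where
  "program = setup_code @ [JumpZero 5 59] @ edge_code @ [Jump 14] @
     [JumpZero 2 81] @ pick_code @ [JumpZero 14 80] @ mark_code @ [Jump 71] @ [Jump 59]"

lemmas code_defs = setup_code_def read_code_def append_code_def edge_code_def pick_code_def
  mark_code_def

lemma code_lengths:
  "length setup_code = 14" "length edge_code = 43" "length pick_code = 11"
  "length mark_code = 7" "length program = 81"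
  by (simp_all add: code_defs program_def)

lemma code_at_program:
  "code_at program 0 setup_code"
  "code_at program 14 [JumpZero 5 59]"
  "code_at program 15 edge_code"
  "code_at program 58 [Jump 14]"
  "code_at program 59 [JumpZero 2 81]"
  "code_at program 60 pick_code"
  "code_at program 71 [JumpZero 14 80]"
  "code_at program 72 mark_code"
  "code_at program 79 [Jump 71]"
  "code_at program 80 [Jump 59]"
  by (simp_all add: code_at_def program_def code_lengths)

lemma straight_code:
  "\<forall>i\<in>set setup_code. straight i" "\<forall>i\<in>set edge_code. straight i"
  "\<forall>i\<in>set pick_code. straight i" "\<forall>i\<in>set mark_code. straight i"
  by (simp_all add: code_defs)

lemma block_ok_append: "block_ok B (xs @ ys) s \<longleftrightarrow> block_ok B xs s \<and> block_ok B ys (fold exec xs s)"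
  by (induction xs arbitrary: s) auto

lemma pc_fold_exec: "\<forall>i\<in>set is. straight i \<Longrightarrow> pc (fold exec is s) = pc s + length is"
proof (induction "is" arbitrary: s)
  case (Cons i "is")
  have "pc (exec i s) = pc s + 1" using Cons.prems by (cases i) auto
  then show ?case using Cons by simp
qed simp

section \<open>Effects of the straight-line blocks\<close>

lemma setup_exec:
  assumes r: "reg s 0 = 0" "reg s 1 = 0"
    and m: "mem s 0 = n" "mem s 1 = \<tau>" "mem s 2 = \<Delta>" "mem s 3 = m"
    and W: "W = n + 3 * m + \<tau> + 6"
    and B: "W \<le> B" "n * W \<le> B"
  defines "s' \<equiv> fold exec setup_code s"
  shows "block_ok B setup_code s"
    and "reg s' 0 = 0" "reg s' 1 = 0" "reg s' 2 = n" "reg s' 3 = W" "reg s' 4 = \<Delta>" "reg s' 5 = m"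
    "reg s' 6 = 4" "reg s' 7 = 1" "reg s' 8 = 2" "reg s' 9 = n * W" "mem s' = mem s"
proof -
  have W': "\<tau> + (3 * m + n) + 6 = W" using W by simp
  show "block_ok B setup_code s"
    using r m B W' by (simp add: setup_code_def del: add_2_eq_Suc add_2_eq_Suc' One_nat_def)
  show "reg s' 0 = 0" "reg s' 1 = 0" "reg s' 2 = n" "reg s' 3 = W" "reg s' 4 = \<Delta>" "reg s' 5 = m"
    "reg s' 6 = 4" "reg s' 7 = 1" "reg s' 8 = 2" "reg s' 9 = n * W" "mem s' = mem s"
    using r m W' unfolding s'_def
    by (simp_all add: setup_code_def del: add_2_eq_Suc add_2_eq_Suc' One_nat_def)
qed

lemma read_exec:
  assumes r: "reg s 3 = W" "reg s 4 = \<Delta>" "reg s 6 = q" "reg s 7 = 1"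
    and m: "mem s q = i" "mem s (q + 1) = j" "mem s (q + 2) = t"
    and lohi: "i - (i - j) = lo" "i + (j - i) = hi" and a: "(hi * W + lo) * W + t = a"
    and LR: "mem s (a - 1) = L" "mem s (a + 1) = R"
    and B: "q + 3 \<le> B" "hi * W + lo \<le> B" "a + 1 + R \<le> B" "L + R + 1 \<le> B" "\<Delta> \<le> B" "bounded B s"
  defines "s' \<equiv> fold exec read_code s"
  shows "block_ok B read_code s"
    and "mem s' = (mem s)(a - L := L + R + 1, a + R := L + R + 1)"
    "reg s' 6 = q + 3" "reg s' 10 = i" "reg s' 11 = j" "reg s' 17 = 1 - (\<Delta> - (L + R + 1))"
    "\<And>x. x \<notin> {6, 10, 11, 12, 13, 14, 15, 16, 17, 18} \<Longrightarrow> reg s' x = reg s x"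
proof -
  have m': "mem s (q + 1 + 1) = t" using m(3) by (simp add: add.assoc)
  have ij: "i \<le> B" "j \<le> B" "t \<le> B" using B(6) m unfolding bounded_def by auto
  have h: "hi \<le> B" "hi * W \<le> B" "hi * W + lo \<le> B" "(hi * W + lo) * W \<le> B" "lo \<le> B"
    using B lohi ij a by auto
  note S = read_code_def lohi r LR a m m'
  show "block_ok B read_code s"
    by (simp add: S del: One_nat_def Suc_eq_plus1 add_2_eq_Suc add_2_eq_Suc',
        intro conjI; use B(1-5) ij h a in linarith)
  show "mem s' = (mem s)(a - L := L + R + 1, a + R := L + R + 1)"
    "reg s' 6 = q + 3" "reg s' 10 = i" "reg s' 11 = j" "reg s' 17 = 1 - (\<Delta> - (L + R + 1))"
    "\<And>x. x \<notin> {6, 10, 11, 12, 13, 14, 15, 16, 17, 18} \<Longrightarrow> reg s' x = reg s x"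
    unfolding s'_def
    by (simp_all add: S del: One_nat_def Suc_eq_plus1 add_2_eq_Suc add_2_eq_Suc')
qed

lemma append_exec:
  assumes r: "reg s 3 = W" "reg s 8 = 2" "reg s 9 = r0" "reg s 17 = f" "reg s x = u" "reg s y = v"
    and xy: "x \<in> {10, 11}" "y \<in> {10, 11}"
    and a: "(r0 + u) * W = a" and d: "mem s a = d"
    and B: "r0 + u \<le> B" "a + 2 + d \<le> B" "d + f \<le> B"
  defines "s' \<equiv> fold exec (append_code x y) s"
  shows "block_ok B (append_code x y) s"
    and "mem s' = (mem s)(a := d + f, a + 2 + d := v)"
    "\<And>z. z \<notin> {13, 14, 15} \<Longrightarrow> reg s' z = reg s z"
proof -
  note S = append_code_def r a d
  have ne: "x \<noteq> 13" "x \<noteq> 14" "x \<noteq> 15" "y \<noteq> 13" "y \<noteq> 14" "y \<noteq> 15"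
    using xy by auto
  show "block_ok B (append_code x y) s"
    using B ne by (simp add: S del: One_nat_def Suc_eq_plus1 add_2_eq_Suc add_2_eq_Suc')
  show "mem s' = (mem s)(a := d + f, a + 2 + d := v)"
    "\<And>z. z \<notin> {13, 14, 15} \<Longrightarrow> reg s' z = reg s z"
    unfolding s'_def using ne
    by (simp_all add: S add_ac del: One_nat_def Suc_eq_plus1 add_2_eq_Suc add_2_eq_Suc')
qed

lemma pick_exec:
  assumes r: "reg s 0 = c" "reg s 2 = Suc v" "reg s 3 = W" "reg s 7 = 1" "reg s 8 = 2" "reg s 9 = r0"
    and a: "(r0 + v) * W = a" and d: "mem s a = d" "mem s (a + 1) = b"
    and B: "c + 1 \<le> B" "v \<le> B" "r0 + v \<le> B" "a + 2 \<le> B" "d \<le> B"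
  defines "s' \<equiv> fold exec pick_code s"
  shows "block_ok B pick_code s"
    and "mem s' = (mem s)(c := v)" "reg s' 0 = c + (1 - b)" "reg s' 2 = v"
    "reg s' 13 = a + 2" "reg s' 14 = d * (1 - b)"
    "\<And>z. z \<notin> {0, 2, 13, 14, 15} \<Longrightarrow> reg s' z = reg s z"
proof -
  note S = pick_code_def r a d
  have db: "d * (1 - b) \<le> B" using B(5) by (cases b) auto
  have cb: "c + (1 - b) \<le> B" "1 - b \<le> B" using B(1) by auto
  have v: "Suc v - 1 = v" by simp
  show "block_ok B pick_code s"
    using B db cb by (simp add: S v del: One_nat_def Suc_eq_plus1 add_2_eq_Suc add_2_eq_Suc')
  show "mem s' = (mem s)(c := v)" "reg s' 0 = c + (1 - b)" "reg s' 2 = v"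
    "reg s' 13 = a + 2" "reg s' 14 = d * (1 - b)"
    "\<And>z. z \<notin> {0, 2, 13, 14, 15} \<Longrightarrow> reg s' z = reg s z"
    unfolding s'_def
    by (simp_all add: S v del: One_nat_def Suc_eq_plus1 add_2_eq_Suc add_2_eq_Suc')
qed

lemma mark_exec:
  assumes r: "reg s 3 = W" "reg s 7 = 1" "reg s 9 = r0" "reg s 13 = a" "reg s 14 = Suc k"
    and u: "mem s (a + k) = u"
    and B: "k \<le> B" "a + k \<le> B" "r0 + u \<le> B" "(r0 + u) * W + 1 \<le> B"
  defines "s' \<equiv> fold exec mark_code s"
  shows "block_ok B mark_code s"
    and "mem s' = (mem s)((r0 + u) * W + 1 := 1)" "reg s' 14 = k"
    "\<And>z. z \<notin> {14, 16} \<Longrightarrow> reg s' z = reg s z"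
proof -
  note S = mark_code_def r u
  have k: "Suc k - 1 = k" by simp
  show "block_ok B mark_code s"
    using B by (simp add: S k del: One_nat_def Suc_eq_plus1 add_2_eq_Suc add_2_eq_Suc')
  show "mem s' = (mem s)((r0 + u) * W + 1 := 1)" "reg s' 14 = k"
    "\<And>z. z \<notin> {14, 16} \<Longrightarrow> reg s' z = reg s z"
    unfolding s'_def
    by (simp_all add: S k del: One_nat_def Suc_eq_plus1 add_2_eq_Suc add_2_eq_Suc')
qed

section \<open>Run lengths\<close>

text \<open>
  The set \<open>{a<..<b}\<close> is a maximal run, possibly empty. Entries inside a run are stale.
\<close>

definition run_table :: "nat \<Rightarrow> nat set \<Rightarrow> (nat \<Rightarrow> nat) \<Rightarrow> bool" where
  "run_table N S T \<longleftrightarrow>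
     (\<forall>a b. a < b \<and> b \<le> N \<and> a \<notin> S \<and> b \<notin> S \<and> {a<..<b} \<subseteq> S \<longrightarrow>
        T (a + 1) = b - a - 1 \<and> T (b - 1) = b - a - 1)"

lemma run_tableD:
  "run_table N S T \<Longrightarrow> a < b \<Longrightarrow> b \<le> N \<Longrightarrow> a \<notin> S \<Longrightarrow> b \<notin> S \<Longrightarrow> {a<..<b} \<subseteq> S
    \<Longrightarrow> T (a + 1) = b - a - 1 \<and> T (b - 1) = b - a - 1"
  unfolding run_table_def by blast

lemma run_table_cong:
  assumes "run_table N S T" "\<And>x. x \<le> N \<Longrightarrow> T' x = T x"
  shows "run_table N S T'"
proof -
  have "T' (a + 1) = T (a + 1) \<and> T' (b - 1) = T (b - 1)" if "a < b" "b \<le> N" for a b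
    using that assms(2) by simp
  then show ?thesis using assms(1) unfolding run_table_def by metis
qed

text \<open>Since \<open>t\<close> is absent, the cells beside it are ends of maximal, possibly
  empty, runs and hence accurate. After the merge, every other run has its end cells at or before
  the gap \<open>a\<close> or at or after the gap \<open>b\<close>, away from the two cells
  written.\<close>

lemma run_table_insert:
  assumes T: "run_table N S T" and S: "S \<subseteq> {1..<N}" and t: "t \<in> {1..<N}" "t \<notin> S"
    and L: "T (t - 1) = L" and R: "T (t + 1) = R"
  shows "L < t" "t + R < N"
    and "run_table N (insert t S) (T(t - L := L + R + 1, t + R := L + R + 1))"
    and "(\<exists>a. {a..<a + \<Delta>} \<subseteq> insert t S) \<longleftrightarrow> (\<exists>a. {a..<a + \<Delta>} \<subseteq> S) \<or> \<Delta> \<le> L + R + 1"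
proof -
  \<comment> \<open>The nearest gaps around \<open>t\<close>. They exist because 0 and
    \<open>N\<close> are never in \<open>S\<close> and act as sentinels.\<close>
  define a where "a = Max {x. x < t \<and> x \<notin> S}"
  define b where "b = (LEAST x. t < x \<and> x \<notin> S)"
  have "0 \<in> {x. x < t \<and> x \<notin> S}" using S t by auto
  then have "a \<in> {x. x < t \<and> x \<notin> S}" unfolding a_def by (intro Max_in) auto
  then have a: "a < t" "a \<notin> S" by auto
  have amax: "x \<le> a" if "x < t" "x \<notin> S" for x
    unfolding a_def using that by (intro Max_ge) auto
  have N: "t < N \<and> N \<notin> S" using S t by auto
  have b: "t < b" "b \<notin> S" using LeastI[of "\<lambda>x. t < x \<and> x \<notin> S", OF N] unfolding b_def by auto
  have bN: "b \<le> N" unfolding b_def using N by (rule Least_le)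
  have bmin: "b \<le> x" if "t < x" "x \<notin> S" for x
    unfolding b_def using that by (intro Least_le) auto
  have run: "{a<..<t} \<subseteq> S" "{t<..<b} \<subseteq> S" using amax bmin by (force simp: not_le[symmetric])+
  have La: "L = t - a - 1" using run_tableD[OF T a(1) _ a(2) t(2) run(1)] L t by auto
  have Rb: "R = b - t - 1" using run_tableD[OF T b(1) bN t(2) b(2) run(2)] R by auto
  show "L < t" "t + R < N" using La Rb a b bN by auto
  have len: "L + R + 1 = b - a - 1" and ends: "t - L = a + 1" "t + R = b - 1"
    using La Rb a b by auto
  show "run_table N (insert t S) (T(t - L := L + R + 1, t + R := L + R + 1))"
    unfolding run_table_def len ends
  proof (intro allI impI, elim conjE)
    fix a' b'
    assume ab: "a' < b'" "b' \<le> N" "a' \<notin> insert t S" "b' \<notin> insert t S" "{a'<..<b'} \<subseteq> insert t S"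
    let ?T = "T(a + 1 := b - a - 1, b - 1 := b - a - 1)"
    \<comment> \<open>A maximal run after the insertion either contains \<open>t\<close>, and is
      then the merged one, or lies on one side of \<open>t\<close>.\<close>
    consider "a' < t" "t < b'" | "b' < t" | "t < a'" using ab by force
    then show "?T (a' + 1) = b' - a' - 1 \<and> ?T (b' - 1) = b' - a' - 1"
    proof cases
      case 1
      have "a' = a"
      proof (rule ccontr)
        assume "a' \<noteq> a"
        then have "a \<in> {a'<..<b'}" using amax[of a'] 1 ab(3) a by auto
        then show False using ab(5) a by auto
      qed
      moreover have "b' = b"
      proof (rule ccontr)
        assume "b' \<noteq> b"
        then have "b \<in> {a'<..<b'}" using bmin[of b'] 1 ab(4) b by auto
        then show False using ab(5) b by auto
      qed
      ultimately show ?thesis by auto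
    next
      case 2
      then have "b' \<le> a" using amax ab(4) by auto
      then have "?T (a' + 1) = T (a' + 1)" "?T (b' - 1) = T (b' - 1)" using ab(1) a b by auto
      moreover have "{a'<..<b'} \<subseteq> S" using ab(5) 2 by auto
      ultimately show ?thesis using run_tableD[OF T ab(1,2)] ab(3,4) by auto
    next
      case 3
      then have "b \<le> a'" using bmin ab(3) by auto
      then have "?T (a' + 1) = T (a' + 1)" "?T (b' - 1) = T (b' - 1)" using ab(1) a b by auto
      moreover have "{a'<..<b'} \<subseteq> S" using ab(5) 3 by auto
      ultimately show ?thesis using run_tableD[OF T ab(1,2)] ab(3,4) by auto
    qed
  qed
  show "(\<exists>a. {a..<a + \<Delta>} \<subseteq> insert t S) \<longleftrightarrow> (\<exists>a. {a..<a + \<Delta>} \<subseteq> S) \<or> \<Delta> \<le> L + R + 1"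
  proof
    assume "\<exists>x. {x..<x + \<Delta>} \<subseteq> insert t S"
    then obtain x where x: "{x..<x + \<Delta>} \<subseteq> insert t S" by blast
    show "(\<exists>a. {a..<a + \<Delta>} \<subseteq> S) \<or> \<Delta> \<le> L + R + 1"
    proof (cases "t \<in> {x..<x + \<Delta>}")
      case True
      \<comment> \<open>A stretch of length \<Delta> through \<open>t\<close> is trapped between the
        gaps, so the merged run is at least as long.\<close>
      have "a \<notin> {x..<x + \<Delta>}" "b \<notin> {x..<x + \<Delta>}" using x a b by auto
      then have "a < x" "x + \<Delta> \<le> b" using True a b by auto
      then show ?thesis unfolding len by auto
    next
      case False
      then show ?thesis using x by blast
    qed
  next
    assume "(\<exists>a. {a..<a + \<Delta>} \<subseteq> S) \<or> \<Delta> \<le> L + R + 1"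
    then show "\<exists>a. {a..<a + \<Delta>} \<subseteq> insert t S"
    proof
      assume "\<Delta> \<le> L + R + 1"
      then have "{a + 1..<a + 1 + \<Delta>} \<subseteq> {a<..<b}" unfolding len using a b by auto
      also have "\<dots> \<subseteq> insert t S"
      proof
        fix x assume "x \<in> {a<..<b}"
        then have "x \<in> {a<..<t} \<or> x = t \<or> x \<in> {t<..<b}" by auto
        then show "x \<in> insert t S" using run by blast
      qed
      finally show ?thesis by blast
    qed blast
  qed
qed

section \<open>The memory layout\<close>

lemma grid_less: "x < K \<Longrightarrow> y < W \<Longrightarrow> x * W + y < K * (W::nat)"
proof -
  assume "x < K" "y < W"
  then have "x * W + y < (x + 1) * W" by simp
  also have "\<dots> \<le> K * W" using \<open>x < K\<close> by (intro mult_right_mono) auto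
  finally show ?thesis .
qed

lemma grid_eq_iff:
  assumes "y < W" "y' < (W::nat)"
  shows "x * W + y = x' * W + y' \<longleftrightarrow> x = x' \<and> y = y'"
proof
  assume eq: "x * W + y = x' * W + y'"
  then have "(x * W + y) div W = (x' * W + y') div W" by simp
  then have "x = x'" using assms by simp
  then show "x = x' \<and> y = y'" using eq by simp
qed simp

section \<open>Conflicts between vertex indices\<close>

definition pair_time :: "nat \<times> nat \<times> nat \<Rightarrow> nat set \<times> nat" where
  "pair_time = (\<lambda>(i, j, t). ({i, j}, t))"

definition edge_times :: "(nat \<times> nat \<times> nat) list \<Rightarrow> nat \<Rightarrow> nat \<Rightarrow> nat set" where
  "edge_times es u v = {t. ({u, v}, t) \<in> pair_time ` set es}"

lemma edge_times_commute: "edge_times es u v = edge_times es v u"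
  by (simp add: edge_times_def insert_commute)

lemma edge_times_snoc:
  "edge_times (es @ [(i, j, t)]) u v = (if {u, v} = {i, j} then insert t (edge_times es u v) else edge_times es u v)"
  by (auto simp: edge_times_def pair_time_def)

text \<open>The start \<open>a\<close> is unrestricted: all time steps lie between 1 and the
  lifetime, so for positive \<Delta> a contained window has an admissible start anyway.\<close>

definition conflict :: "nat \<Rightarrow> (nat \<times> nat \<times> nat) list \<Rightarrow> nat \<Rightarrow> nat \<Rightarrow> bool" where
  "conflict \<Delta> es u v \<longleftrightarrow> (\<exists>a. {a..<a + \<Delta>} \<subseteq> edge_times es u v)"

lemma conflict_commute: "conflict \<Delta> es u v \<longleftrightarrow> conflict \<Delta> es v u"
  by (simp add: conflict_def edge_times_commute)

text \<open>
  Memory is a grid of rows of width \<open>W\<close>: row 0 contains the input and later the output, row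
  \<open>hi * W + lo\<close> the run lengths of the pair \<open>lo < hi\<close>, and row \<open>n * W + v\<close> the degree of
  \<open>v\<close>, its blocking mark, and its neighbours.
\<close>

locale layout =
  fixes n \<tau> m W :: nat
  \<comment> \<open>A width exceeding the \<open>4 + 3 * m\<close> input words, the \<open>n\<close>
    output words, times up to \<open>\<tau> + 1\<close>, and columns up to \<open>m + 2\<close> of a
    vertex row.\<close>
  assumes W_def: "W = n + 3 * m + \<tau> + 6"
begin

definition vrow :: "nat \<Rightarrow> nat" where
  "vrow v = (n * W + v) * W"

text \<open>The bound \<open>m\<close> keeps each list inside its row. Cells beyond the list are
  arbitrary, since an uncounted neighbour may have been written there.\<close>

definition adj_rep :: "(nat \<Rightarrow> nat) \<Rightarrow> (nat \<Rightarrow> nat list) \<Rightarrow> bool" where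
  "adj_rep M A \<longleftrightarrow> (\<forall>v<n. M (vrow v) = length (A v) \<and> length (A v) \<le> m \<and>
     (\<forall>k<length (A v). M (vrow v + 2 + k) = A v ! k))"

definition blocked :: "(nat \<Rightarrow> nat) \<Rightarrow> nat set \<Rightarrow> bool" where
  "blocked M X \<longleftrightarrow> (\<forall>v<n. M (vrow v + 1) = (if v \<in> X then 1 else 0))"

text \<open>With the bound \<open>\<tau> + 1\<close>, the times 0 and \<open>\<tau> + 1\<close>,
  which no time-edge uses, are the sentinels of each run table.\<close>

definition tables :: "(nat \<Rightarrow> nat) \<Rightarrow> (nat \<times> nat \<times> nat) list \<Rightarrow> bool" where
  "tables M es \<longleftrightarrow>
     (\<forall>hi<n. \<forall>lo<hi. run_table (\<tau> + 1) (edge_times es lo hi) (\<lambda>t. M ((hi * W + lo) * W + t)))"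

lemma vrow_ge: "n * W * W \<le> vrow v"
  unfolding vrow_def by (simp add: algebra_simps)

lemma vrow_eq_iff:
  "y < W \<Longrightarrow> y' < W \<Longrightarrow> vrow u + y = vrow v + y' \<longleftrightarrow> u = v \<and> y = y'"
  unfolding vrow_def using grid_eq_iff[of y W y' "n * W + u" "n * W + v"] by simp

lemma vrow_bound: "v < n \<Longrightarrow> y < W \<Longrightarrow> vrow v + y < W * W * W"
  unfolding vrow_def using W_def by (intro grid_less) auto

lemma vrow_ge_W: "v < n \<Longrightarrow> W \<le> vrow v"
proof -
  assume "v < n"
  then have "1 \<le> n * W + v" using W_def by (cases n) auto
  from mult_right_mono[OF this, of W] show ?thesis unfolding vrow_def by simp
qed

text \<open>With \<open>pair_ge_W\<close> and \<open>vrow_ge\<close>, this places the pair rows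
  strictly between row 0 and the vertex rows.\<close>

lemma pair_less: "hi < n \<Longrightarrow> lo < hi \<Longrightarrow> t < W \<Longrightarrow> (hi * W + lo) * W + t < n * W * W"
  using W_def by (intro grid_less) auto

lemma pair_ge_W: "lo < hi \<Longrightarrow> W \<le> (hi * W + lo) * W + t"
proof -
  assume "lo < hi"
  then have "1 \<le> hi * W + lo" using W_def by (cases hi) auto
  then have "1 * W \<le> (hi * W + lo) * W" by (intro mult_right_mono) auto
  then show ?thesis unfolding mult_1 by (rule trans_le_add1)
qed

text \<open>Column 1 is exempt so that marking a vertex preserves the lists.\<close>

lemma adj_rep_cong:
  assumes "adj_rep M A" "\<And>v y. v < n \<Longrightarrow> y < W \<Longrightarrow> y \<noteq> 1 \<Longrightarrow> M' (vrow v + y) = M (vrow v + y)"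
  shows "adj_rep M' A"
  unfolding adj_rep_def
proof (intro allI impI)
  fix v assume v: "v < n"
  have A: "M (vrow v) = length (A v)" "length (A v) \<le> m"
    "\<And>k. k < length (A v) \<Longrightarrow> M (vrow v + 2 + k) = A v ! k"
    using assms(1) v unfolding adj_rep_def by auto
  have "M' (vrow v) = M (vrow v)" using assms(2)[OF v, of 0] W_def by simp
  moreover have "M' (vrow v + 2 + k) = M (vrow v + 2 + k)" if "k < length (A v)" for k
    using assms(2)[OF v, of "2 + k"] that A(2) W_def by (simp add: add.assoc)
  ultimately show "M' (vrow v) = length (A v) \<and> length (A v) \<le> m \<and>
      (\<forall>k<length (A v). M' (vrow v + 2 + k) = A v ! k)"
    using A by simp
qed

lemma adj_rep_append:
  assumes A: "adj_rep M A" and u: "u < n" "length (A u) < m" and f: "f \<le> 1"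
  shows "adj_rep (M(vrow u := length (A u) + f, vrow u + 2 + length (A u) := y))
     (A(u := A u @ (if f = 1 then [y] else [])))" (is "adj_rep ?M ?A")
  unfolding adj_rep_def
proof (intro allI impI)
  fix v assume v: "v < n"
  have Av: "M (vrow v) = length (A v)" "length (A v) \<le> m"
    "\<And>k. k < length (A v) \<Longrightarrow> M (vrow v + 2 + k) = A v ! k"
    using A v unfolding adj_rep_def by auto
  have ne: "vrow x + 2 + k \<noteq> vrow z" if "k \<le> m" for x z k
    using vrow_eq_iff[of "2 + k" 0 x z] that W_def by (simp add: add.assoc)
  have eq: "vrow x + 2 + k = vrow z + 2 + k' \<longleftrightarrow> x = z \<and> k = k'" if "k \<le> m" "k' \<le> m" for x z k k'
    using vrow_eq_iff[of "2 + k" "2 + k'" x z] that W_def by (simp add: add.assoc)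
  have eq0: "vrow x = vrow z \<longleftrightarrow> x = z" for x z
    using vrow_eq_iff[of 0 0 x z] W_def by simp
  show "?M (vrow v) = length (?A v) \<and> length (?A v) \<le> m \<and>
      (\<forall>k<length (?A v). ?M (vrow v + 2 + k) = ?A v ! k)"
  proof (intro conjI allI impI)
    show "?M (vrow v) = length (?A v)"
      using Av ne[of "length (A u)" u v] eq0[of v u] u f by auto
    show "length (?A v) \<le> m" using Av u by auto
    fix k assume k: "k < length (?A v)"
    have km: "k \<le> m" using k Av u by (auto split: if_splits)
    show "?M (vrow v + 2 + k) = ?A v ! k"
      using k Av ne[OF km, of v u] eq[OF km, of "length (A u)" v u] u
      by (auto simp: nth_append less_Suc_eq split: if_splits)
  qed
qed

lemma blocked_cong:
  assumes "blocked M X" "\<And>v. v < n \<Longrightarrow> M' (vrow v + 1) = M (vrow v + 1)"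
  shows "blocked M' X"
  using assms unfolding blocked_def by auto

lemma blocked_mark:
  assumes "blocked M X" "u < n"
  shows "blocked (M(vrow u + 1 := 1)) (insert u X)"
  using assms vrow_eq_iff[of 1 1] W_def unfolding blocked_def by auto

lemma tables_cong:
  assumes "tables M es" "\<And>a. W \<le> a \<Longrightarrow> a < n * W * W \<Longrightarrow> M' a = M a"
  shows "tables M' es"
  unfolding tables_def
proof (intro allI impI)
  fix hi lo assume hl: "hi < n" "lo < hi"
  show "run_table (\<tau> + 1) (edge_times es lo hi) (\<lambda>t. M' ((hi * W + lo) * W + t))"
  proof (rule run_table_cong)
    show "run_table (\<tau> + 1) (edge_times es lo hi) (\<lambda>t. M ((hi * W + lo) * W + t))"
      using assms(1) hl unfolding tables_def by blast
    show "M' ((hi * W + lo) * W + t) = M ((hi * W + lo) * W + t)" if "t \<le> \<tau> + 1" for t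
      using that hl W_def by (intro assms(2) pair_ge_W pair_less) auto
  qed
qed

text \<open>Different pairs own different rows, so this is \<open>run_table_insert\<close> in a
  single row; the bounds on \<open>L\<close> and \<open>R\<close> keep both written cells inside
  it.\<close>

lemma tables_insert:
  assumes M: "tables M es" and lohi: "lo < hi" "hi < n" and eij: "{lo, hi} = {i, j}"
    and S: "edge_times es lo hi \<subseteq> {1..\<tau>}" and t: "t \<in> {1..\<tau>}" "t \<notin> edge_times es lo hi"
    and a: "a = (hi * W + lo) * W + t" and L: "M (a - 1) = L" and R: "M (a + 1) = R"
  shows "L < t" "t + R \<le> \<tau>"
    and "tables (M(a - L := L + R + 1, a + R := L + R + 1)) (es @ [(i, j, t)])" (is "tables ?M _")
    and "conflict \<Delta> (es @ [(i, j, t)]) lo hi \<longleftrightarrow> conflict \<Delta> es lo hi \<or> \<Delta> \<le> L + R + 1"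
proof -
  let ?r = "hi * W + lo" and ?S = "edge_times es lo hi"
  have T: "run_table (\<tau> + 1) ?S (\<lambda>t. M (?r * W + t))"
    using M lohi unfolding tables_def by blast
  have S': "?S \<subseteq> {1..<\<tau> + 1}" and t': "t \<in> {1..<\<tau> + 1}" using S t by auto
  have L': "M (?r * W + (t - 1)) = L" and R': "M (?r * W + (t + 1)) = R"
    using L R a t by (simp_all add: add.assoc)
  note ins = run_table_insert[OF T S' t' t(2) L' R']
  show Lt: "L < t" and Rt: "t + R \<le> \<tau>" using ins(1,2) by auto
  have ins_eq: "edge_times (es @ [(i, j, t)]) lo hi = insert t ?S"
    using eij by (simp add: edge_times_snoc)
  show "conflict \<Delta> (es @ [(i, j, t)]) lo hi \<longleftrightarrow> conflict \<Delta> es lo hi \<or> \<Delta> \<le> L + R + 1"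
    unfolding conflict_def ins_eq by (rule ins(4))
  have aL: "a - L = ?r * W + (t - L)" and aR: "a + R = ?r * W + (t + R)" using a Lt by auto
  show "tables ?M (es @ [(i, j, t)])"
    unfolding tables_def
  proof (intro allI impI)
    fix hi' lo' assume hl: "hi' < n" "lo' < hi'"
    let ?r' = "hi' * W + lo'"
    have req: "?r' = ?r \<longleftrightarrow> hi' = hi \<and> lo' = lo"
      using hl lohi W_def by (intro grid_eq_iff) auto
    have upd: "?M (?r' * W + x) =
       (if ?r' = ?r then ((\<lambda>t. M (?r * W + t))(t - L := L + R + 1, t + R := L + R + 1)) x
        else M (?r' * W + x))" if "x \<le> \<tau> + 1" for x
    proof -
      have "?r' * W + x = a - L \<longleftrightarrow> ?r' = ?r \<and> x = t - L"
        unfolding aL using that t W_def by (intro grid_eq_iff) auto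
      moreover have "?r' * W + x = a + R \<longleftrightarrow> ?r' = ?r \<and> x = t + R"
        unfolding aR using that Rt W_def by (intro grid_eq_iff) auto
      ultimately show ?thesis by auto
    qed
    show "run_table (\<tau> + 1) (edge_times (es @ [(i, j, t)]) lo' hi') (\<lambda>t. ?M (?r' * W + t))"
    proof (cases "hi' = hi \<and> lo' = lo")
      case True
      show ?thesis
        unfolding True[THEN conjunct1] True[THEN conjunct2] ins_eq
        by (rule run_table_cong[OF ins(3)]) (use upd True in simp)
    next
      case False
      then have "{lo', hi'} \<noteq> {i, j}" unfolding eij[symmetric] using hl lohi
        by (auto simp: doubleton_eq_iff)
      then have "edge_times (es @ [(i, j, t)]) lo' hi' = edge_times es lo' hi'" by (simp add: edge_times_snoc)
      moreover have "run_table (\<tau> + 1) (edge_times es lo' hi') (\<lambda>t. M (?r' * W + t))"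
        using M hl unfolding tables_def by blast
      ultimately show ?thesis using False req upd by (auto intro: run_table_cong)
    qed
  qed
qed

end

section \<open>The loop over the time-edges\<close>

locale edge_loop = layout +
  fixes \<Delta> B :: nat and es :: "(nat \<times> nat \<times> nat) list"
  assumes m_def: "m = length es"
    and edges: "(i, j, t) \<in> set es \<Longrightarrow> i < n \<and> j < n \<and> i \<noteq> j \<and> 1 \<le> t \<and> t \<le> \<tau>"
    and distinct_es: "distinct (map pair_time es)"
    and \<Delta>: "1 \<le> \<Delta>" "\<Delta> \<le> \<tau>"
    and B: "W * W * W \<le> B"
begin

definition input_rep :: "(nat \<Rightarrow> nat) \<Rightarrow> bool" where
  "input_rep M \<longleftrightarrow> (\<forall>q<m. (M (4 + 3 * q), M (4 + 3 * q + 1), M (4 + 3 * q + 2)) = es ! q)"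

text \<open>Only the sets of entries are fixed: a pair is appended again by each later time-edge
  whose merged run is long enough. The bound on the total length pays for these duplicates in the
  greedy phase.\<close>

definition adj_lists :: "nat \<Rightarrow> (nat \<Rightarrow> nat list) \<Rightarrow> bool" where
  "adj_lists q A \<longleftrightarrow>
     (\<forall>v<n. set (A v) = {u. u < n \<and> conflict \<Delta> (take q es) v u} \<and> length (A v) \<le> q) \<and>
     (\<Sum>v<n. length (A v)) \<le> 2 * q"

definition edge_inv :: "nat \<Rightarrow> (nat \<Rightarrow> nat list) \<Rightarrow> ram_state \<Rightarrow> bool" where
  "edge_inv q A s \<longleftrightarrow> bounded B s \<and>
     reg s 0 = 0 \<and> reg s 1 = 0 \<and> reg s 2 = n \<and> reg s 3 = W \<and> reg s 4 = \<Delta> \<and> reg s 5 = m - q \<and>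
     reg s 6 = 4 + 3 * q \<and> reg s 7 = 1 \<and> reg s 8 = 2 \<and> reg s 9 = n * W \<and>
     input_rep (mem s) \<and> tables (mem s) (take q es) \<and> adj_rep (mem s) A \<and> adj_lists q A \<and>
     blocked (mem s) {}"

lemma W_le_B: "W \<le> B" "W * W \<le> B"
proof -
  have "W * 1 \<le> W * W" "W * W * 1 \<le> W * W * W" using W_def by (intro mult_left_mono; simp)+
  then show "W \<le> B" "W * W \<le> B" using B by linarith+
qed

lemma nW_less: "v < n \<Longrightarrow> n * W + v < W * W"
  using W_def by (intro grid_less) auto

lemma edge_times_subset: "edge_times (take q es) u v \<subseteq> {1..\<tau>}"
proof
  fix t assume "t \<in> edge_times (take q es) u v"
  then obtain i j where "(i, j, t) \<in> set (take q es)"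
    unfolding edge_times_def pair_time_def by auto
  from edges[OF in_set_takeD[OF this]] show "t \<in> {1..\<tau>}" by simp
qed

text \<open>Distinctness of the time-edges enters here, since run merging presupposes a new time
  step.\<close>

lemma edge_times_fresh:
  assumes "q < m" "es ! q = (i, j, t)"
  shows "t \<notin> edge_times (take q es) i j"
proof
  assume "t \<in> edge_times (take q es) i j"
  then have "pair_time (es ! q) \<in> set (map pair_time (take q es))"
    unfolding edge_times_def pair_time_def using assms by auto
  moreover have "distinct (map pair_time (take (Suc q) es))"
    using distinct_take[OF distinct_es, of "Suc q"] by (simp only: take_map)
  ultimately show False using assms(1) m_def by (simp add: take_Suc_conv_app_nth)
qed

lemma edge_step:
  assumes inv: "edge_inv q A s" and q: "q < m"
  shows "block_ok B edge_code s"
    and "\<exists>A'. edge_inv (Suc q) A' (fold exec edge_code s)"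
proof -
  obtain i j t where e: "es ! q = (i, j, t)" by (cases "es ! q")
  have ein: "(i, j, t) \<in> set es" using q e m_def nth_mem by metis
  note ijt = edges[OF ein]
  have take_q: "take (Suc q) es = take q es @ [(i, j, t)]"
    using q e m_def by (simp add: take_Suc_conv_app_nth)
  have inv_regs: "reg s 0 = 0" "reg s 1 = 0" "reg s 2 = n" "reg s 3 = W" "reg s 4 = \<Delta>"
    "reg s 5 = m - q" "reg s 6 = 4 + 3 * q" "reg s 7 = 1" "reg s 8 = 2" "reg s 9 = n * W"
    and bnd: "bounded B s" and inp: "input_rep (mem s)" and tab: "tables (mem s) (take q es)"
    and adj: "adj_rep (mem s) A" and lists: "adj_lists q A" and blk: "blocked (mem s) {}"
    using inv unfolding edge_inv_def by auto
  define lo hi where "lo = i - (i - j)" and "hi = i + (j - i)"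
  have lohi: "lo < hi" "hi < n" "{lo, hi} = {i, j}"
    unfolding lo_def hi_def using ijt by (cases "i < j"; auto)+
  define a where "a = (hi * W + lo) * W + t"
  define L R where "L = mem s (a - 1)" and "R = mem s (a + 1)"
  define len where "len = L + R + 1"
  have mem_in: "mem s (4 + 3 * q) = i" "mem s (4 + 3 * q + 1) = j" "mem s (4 + 3 * q + 2) = t"
    using inp q e unfolding input_rep_def by auto
  have fresh: "t \<notin> edge_times (take q es) lo hi"
    using edge_times_fresh[OF q e] lohi(3) unfolding edge_times_def by simp
  note ins = tables_insert[OF tab lohi edge_times_subset _ fresh a_def L_def[symmetric]
      R_def[symmetric], folded take_q len_def]
  have t: "t \<in> {1..\<tau>}" using ijt by auto
  have Lt: "L < t" and tR: "t + R \<le> \<tau>" using ins(1,2)[OF t] by auto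
  have row: "hi * W + lo < W * W" "hi * W + lo < n * W"
    using lohi W_def by (intro grid_less; simp)+
  have addr: "(hi * W + lo) * W + x < W * W * W" if "x < W" for x
    using grid_less[OF row(1) that] .
  have s_bounds: "4 + 3 * q + 3 \<le> B" "hi * W + lo \<le> B" "a + 1 + R \<le> B" "L + R + 1 \<le> B" "\<Delta> \<le> B"
    using addr[of "t + (1 + R)"] Lt tR q W_def W_le_B B row \<Delta> unfolding a_def by simp_all
  define s1 where "s1 = fold exec read_code s"
  note read = read_exec[OF inv_regs(4,5,7,8) mem_in lo_def[symmetric] hi_def[symmetric]
      a_def[symmetric] L_def[symmetric] R_def[symmetric] s_bounds bnd, folded s1_def len_def]
  define f where "f = 1 - (\<Delta> - len)"
  have f: "f \<le> 1" "f = 1 \<longleftrightarrow> \<Delta> \<le> len" unfolding f_def by auto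
  have aL: "a - L = (hi * W + lo) * W + (t - L)" and aR: "a + R = (hi * W + lo) * W + (t + R)"
    unfolding a_def using Lt by auto
  have aLR: "W \<le> a - L" "a - L < n * W * W" "W \<le> a + R" "a + R < n * W * W"
    unfolding aL aR
    by (rule pair_ge_W pair_less lohi, use lohi(1,2) tR ijt W_def in simp)+
  \<comment> \<open>The reading block writes only to pair rows, so input and vertex rows
    survive.\<close>
  have mem1: "mem s1 x = mem s x" if "x < W \<or> n * W * W \<le> x" for x
    unfolding read(2) using aLR that by auto
  have adj1: "adj_rep (mem s1) A"
    using mem1 vrow_ge by (intro adj_rep_cong[OF adj]) (simp add: trans_le_add1)
  have blk1: "blocked (mem s1) {}"
    using mem1 vrow_ge by (intro blocked_cong[OF blk]) (metis trans_le_add1)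
  have tab1: "tables (mem s1) (take (Suc q) es)"
    unfolding read(2) using ins(3)[OF t] .
  have lenA: "length (A v) \<le> q" if "v < n" for v using lists that unfolding adj_lists_def by blast
  have degA: "mem s1 (vrow v) = length (A v)" if "v < n" for v
    using adj1 that unfolding adj_rep_def by blast
  have app_bounds: "n * W + v \<le> B" "vrow v + 2 + l \<le> B" "l + f \<le> B"
    if "v < n" "l \<le> q" for v l
    using nW_less[OF that(1)] vrow_bound[OF that(1), of "2 + l"] that(2) q f(1) W_def W_le_B B
    by (simp_all add: add.assoc)
  define s2 where "s2 = fold exec (append_code 10 11) s1"
  have r1: "reg s1 3 = W" "reg s1 8 = 2" "reg s1 9 = n * W" "reg s1 17 = f"
    using read(5,6,7) inv_regs f_def by simp_all
  have vi: "(n * W + v) * W = vrow v" for v unfolding vrow_def ..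
  have i: "i < n" and j: "j < n" and ij: "i \<noteq> j" using ijt by auto
  note app1 = append_exec[OF r1 read(4) read(5) _ _ vi degA[OF i] app_bounds[OF i lenA[OF i]],
      folded s2_def]
  define X where "X y = (if f = 1 then [y] else [])" for y :: nat
  define A2 where "A2 = A(i := A i @ X j)"
  have mem2: "mem s2 = (mem s1)(vrow i := length (A i) + f, vrow i + 2 + length (A i) := j)"
    using app1(2) by simp
  have ok1: "block_ok B (append_code 10 11) s1"
    using app1(1) by simp
  have reg2: "reg s2 z = reg s1 z" if "z \<notin> {13, 14, 15}" for z
    using app1(3)[of z] that by simp
  have adj2: "adj_rep (mem s2) A2"
    unfolding mem2 A2_def X_def using lenA[OF i] q f by (intro adj_rep_append[OF adj1 i]) auto
  \<comment> \<open>The endpoints differ, so the first append leaves the list of \<open>j\<close>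
    alone.\<close>
  have A2j: "A2 j = A j" unfolding A2_def using ij by simp
  have d2: "mem s2 (vrow j) = length (A j)" using adj2 j A2j unfolding adj_rep_def by metis
  define s3 where "s3 = fold exec (append_code 11 10) s2"
  have r2: "reg s2 3 = W" "reg s2 8 = 2" "reg s2 9 = n * W" "reg s2 17 = f" "reg s2 11 = j"
    "reg s2 10 = i" using reg2 r1 read(4,5) by simp_all
  note app2 = append_exec[OF r2 _ _ vi d2 app_bounds[OF j lenA[OF j]], folded s3_def]
  have mem3: "mem s3 = (mem s2)(vrow j := length (A j) + f, vrow j + 2 + length (A j) := i)"
    and ok2: "block_ok B (append_code 11 10) s2"
    and reg3: "z \<notin> {13, 14, 15} \<Longrightarrow> reg s3 z = reg s2 z" for z
    using app2 by simp_all
  define A3 where "A3 = A2(j := A2 j @ X i)"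
  have adj3: "adj_rep (mem s3) A3"
    unfolding mem3 A3_def X_def using lenA[OF j] q f A2j
    by (metis adj_rep_append[OF adj2 j, of f i] le_less_trans)
  \<comment> \<open>The two appends write only to vertex rows.\<close>
  have low: "mem s3 x = mem s1 x" if "x < n * W * W" for x
  proof -
    have "x < vrow v" for v using vrow_ge[of v] that by linarith
    then have "x \<noteq> vrow v \<and> x \<noteq> vrow v + 2 + l" for v l
      by (metis add.assoc less_irrefl not_add_less1)
    then show ?thesis unfolding mem3 mem2 by simp
  qed
  have tab3: "tables (mem s3) (take (Suc q) es)" using low by (intro tables_cong[OF tab1]) auto
  have blk3: "blocked (mem s3) {}"
  proof (rule blocked_cong[OF blk1])
    fix v assume "v < n"
    have "vrow v + 1 \<noteq> vrow u" "vrow v + 1 \<noteq> vrow u + (2 + l)" if "l \<le> q" for u l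
      using vrow_eq_iff[of 1 0 v u] vrow_eq_iff[of 1 "2 + l" v u] that q W_def by auto
    then show "mem s3 (vrow v + 1) = mem s1 (vrow v + 1)"
      unfolding mem3 mem2 using lenA[OF i] lenA[OF j] by (simp add: add.assoc)
  qed
  \<comment> \<open>A time-edge forces \<open>n\<close> to be positive, so row 0 lies below the
    vertex rows.\<close>
  have "W * 1 \<le> W * (n * W)" using i W_def by (intro mult_left_mono) auto
  then have WnWW: "W \<le> n * W * W" by (simp add: mult.commute)
  have "mem s3 x = mem s x" if "x < W" for x
    using low[OF less_le_trans[OF that WnWW]] mem1[of x] that by simp
  moreover have "4 + 3 * k < W" "4 + 3 * k + 1 < W" "4 + 3 * k + 2 < W" if "k < m" for k
    using that W_def by simp_all
  ultimately have inp3: "input_rep (mem s3)" using inp unfolding input_rep_def by metis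
  define s4 where "s4 = exec (Sub 5 5 7) s3"
  have s4: "fold exec edge_code s = s4"
    unfolding edge_code_def s4_def s3_def s2_def s1_def by simp
  have reg03: "reg s3 z = reg s z" if "z \<in> {0, 1, 2, 3, 4, 5, 7, 8, 9}" for z
    using that reg3[of z] reg2[of z] read(7)[of z] by auto
  have reg6: "reg s3 6 = 4 + 3 * Suc q" using reg3[of 6] reg2[of 6] read(3) by simp
  have r4: "mem s4 = mem s3" "reg s4 5 = reg s3 5 - reg s3 7" "z \<noteq> 5 \<Longrightarrow> reg s4 z = reg s3 z" for z
    unfolding s4_def by simp_all
  have reg3_5: "reg s3 5 \<le> B" using reg03[of 5] inv_regs(6) W_def W_le_B(1) by simp
  show ok: "block_ok B edge_code s"
    unfolding edge_code_def block_ok_append s1_def[symmetric] s2_def[symmetric] s3_def[symmetric]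
    using read(1) ok1 ok2 reg3_5 by simp
  have bnd4: "bounded B s4" unfolding s4[symmetric] using bnd ok by (rule bounded_fold_exec)
  have confl: "conflict \<Delta> (take (Suc q) es) v u \<longleftrightarrow>
      conflict \<Delta> (take q es) v u \<or> f = 1 \<and> {v, u} = {i, j}" for v u
  proof (cases "{v, u} = {i, j}")
    case True
    then have "{v, u} = {lo, hi}" using lohi by simp
    then have "v = lo \<and> u = hi \<or> v = hi \<and> u = lo" by (simp add: doubleton_eq_iff)
    then show ?thesis using True ins(4)[OF t, of \<Delta>] f(2) conflict_commute by auto
  next
    case False
    then show ?thesis unfolding conflict_def take_q edge_times_snoc by auto
  qed
  have setX: "set (X y) = (if f = 1 then {y} else {})" "length (X y) \<le> 1" for y
    unfolding X_def by auto
  have A3: "A3 v = (if v = i then A i @ X j else if v = j then A j @ X i else A v)" for v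
    unfolding A3_def A2_def using ij by auto
  have "adj_lists (Suc q) A3"
    unfolding adj_lists_def
  proof (intro conjI allI impI)
    fix v assume v: "v < n"
    have "set (A v) = {u. u < n \<and> conflict \<Delta> (take q es) v u}"
      using lists v unfolding adj_lists_def by blast
    then show "set (A3 v) = {u. u < n \<and> conflict \<Delta> (take (Suc q) es) v u}"
      unfolding A3 confl using i j ij setX by (auto simp: doubleton_eq_iff)
    show "length (A3 v) \<le> Suc q"
      unfolding A3 using lenA[OF v] setX(2)[of i] setX(2)[of j] by auto
  next
    \<comment> \<open>Only the lists of the two endpoints grow, each by at most one entry.\<close>
    have "(\<Sum>v<n. length (A3 v)) \<le> (\<Sum>v<n. length (A v) + ((if v = i then 1 else 0) + (if v = j then 1 else 0)))"
      using setX(2) ij by (intro sum_mono) (auto simp: A3)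
    also have "\<dots> = (\<Sum>v<n. length (A v)) + 2" using i j by (simp add: sum.distrib)
    finally show "(\<Sum>v<n. length (A3 v)) \<le> 2 * Suc q"
      using lists unfolding adj_lists_def by simp
  qed
  then have "edge_inv (Suc q) A3 s4"
    unfolding edge_inv_def
    using bnd4 r4 reg03 reg6 inv_regs inp3 tab3 adj3 blk3 by simp
  then show "\<exists>A'. edge_inv (Suc q) A' (fold exec edge_code s)" unfolding s4 by blast
qed

end

lemma bounded_pc [simp]: "bounded B (s\<lparr>pc := l\<rparr>) = bounded B s"
  by (simp add: bounded_def)

context edge_loop
begin

lemma edge_inv_pc [simp]: "edge_inv q A (s\<lparr>pc := l\<rparr>) = edge_inv q A s"
  by (simp add: edge_inv_def)

text \<open>A round costs one test, 43 instructions and one jump; the last 1 is the failing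
  test.\<close>

lemma edge_loop_runs:
  assumes "edge_inv q A s" "pc s = 14" "q \<le> m"
  shows "\<exists>A' s'. runs program B (45 * (m - q) + 1) s s' \<and> pc s' = 59 \<and> edge_inv m A' s'"
  using assms
proof (induction "m - q" arbitrary: q A s)
  case 0
  then have q: "q = m" by simp
  have "bounded B s" "reg s 5 = 0" using 0 q unfolding edge_inv_def by auto
  with runs_JumpZero[of program s 5 59 B] code_at_program(2) 0(3)
  have "runs program B 1 s (s\<lparr>pc := 59\<rparr>)" by simp
  then show ?case using 0 q by (intro exI[of _ A] exI[of _ "s\<lparr>pc := 59\<rparr>"]) simp
next
  case (Suc k)
  have q: "q < m" and k: "k = m - Suc q" using Suc by auto
  have inv: "edge_inv q A s" and pc: "pc s = 14" using Suc by auto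
  have b: "bounded B s" and "reg s 5 \<noteq> 0" using inv q unfolding edge_inv_def by auto
  with runs_JumpZero[of program s 5 59 B] code_at_program(2) pc
  have r1: "runs program B 1 s (s\<lparr>pc := 15\<rparr>)" by simp
  let ?s1 = "s\<lparr>pc := 15\<rparr>"
  define s2 where "s2 = fold exec edge_code ?s1"
  have inv1: "edge_inv q A ?s1" using inv by simp
  have r2: "runs program B 43 ?s1 s2"
    using runs_block[OF _ straight_code(2) edge_step(1)[OF inv1 q]] b code_at_program(3)
    unfolding s2_def by (simp add: code_lengths)
  have pc2: "pc s2 = 58"
    unfolding s2_def using pc_fold_exec[OF straight_code(2), of ?s1] by (simp add: code_lengths)
  obtain A2 where inv2: "edge_inv (Suc q) A2 s2" using edge_step(2)[OF inv1 q] unfolding s2_def by blast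
  have r3: "runs program B 1 s2 (s2\<lparr>pc := 14\<rparr>)"
    using runs_Jump[of program s2 14 B] code_at_program(4) pc2 runs_bounded[OF r2] by simp
  obtain A' s' where IH: "runs program B (45 * (m - Suc q) + 1) (s2\<lparr>pc := 14\<rparr>) s'"
    "pc s' = 59" "edge_inv m A' s'"
    using Suc(1)[OF k, of A2 "s2\<lparr>pc := 14\<rparr>"] inv2 q by auto
  have "1 + 43 + 1 + (45 * (m - Suc q) + 1) = 45 * (m - q) + 1" using q by simp
  with runs_trans[OF runs_trans[OF runs_trans[OF r1 r2] r3] IH(1)] IH(2,3)
  show ?case by metis
qed

end

section \<open>The greedy loop\<close>

text \<open>Symmetry lets a missing mark on a new vertex exclude adjacency to the chosen ones in
  both directions; irreflexivity is there because \<open>independent_set\<close> also forbids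
  loops.\<close>

locale greedy_loop = layout +
  fixes B :: nat and A :: "nat \<Rightarrow> nat list"
  assumes B: "W * W * W \<le> B"
    and nbr_less: "v < n \<Longrightarrow> u \<in> set (A v) \<Longrightarrow> u < n"
    and nbr_sym: "u < n \<Longrightarrow> v < n \<Longrightarrow> u \<in> set (A v) \<Longrightarrow> v \<in> set (A u)"
    and nbr_irrefl: "v < n \<Longrightarrow> v \<notin> set (A v)"
begin

lemma row_bounds:
  assumes "v < n"
  shows "n * W + v \<le> B" and "y < W \<Longrightarrow> vrow v + y \<le> B"
proof -
  show *: "vrow v + y \<le> B" if "y < W" for y using vrow_bound[OF assms that] B by simp
  have "(n * W + v) * 1 \<le> vrow v" unfolding vrow_def using W_def by (intro mult_left_mono) auto
  then show "n * W + v \<le> B" using *[of 0] W_def by simp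
qed

text \<open>The list is consumed from its end, so \<open>take k\<close> is the part still to be
  marked; each entry costs a test, 7 instructions and a jump.\<close>

lemma mark_loop_runs:
  assumes "bounded B s" "reg s 3 = W" "reg s 7 = 1" "reg s 9 = n * W" "reg s 13 = vrow v + 2"
    "reg s 14 = k" "k \<le> length (A v)" "v < n" "pc s = 71" "adj_rep (mem s) A" "blocked (mem s) X"
  shows "\<exists>s'. runs program B (9 * k + 1) s s' \<and> pc s' = 80 \<and> adj_rep (mem s') A \<and>
     blocked (mem s') (X \<union> set (take k (A v))) \<and> (\<forall>x<W. mem s' x = mem s x) \<and>
     (\<forall>z. z \<notin> {14, 16} \<longrightarrow> reg s' z = reg s z)"
  using assms
proof (induction k arbitrary: s X)
  case 0
  with runs_JumpZero[of program s 14 80 B] code_at_program(7)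
  have "runs program B 1 s (s\<lparr>pc := 80\<rparr>)" by simp
  then show ?case using 0 by (intro exI[of _ "s\<lparr>pc := 80\<rparr>"]) simp
next
  case (Suc k)
  note pre = Suc.prems
  define u where "u = A v ! k"
  have k: "k < length (A v)" using pre(7) by simp
  then have uA: "u \<in> set (A v)" unfolding u_def by simp
  then have u: "u < n" using nbr_less pre(8) by blast
  have "length (A v) \<le> m" and mu: "mem s (vrow v + 2 + k) = u"
    using pre(8,10) k unfolding adj_rep_def u_def by auto
  then have km: "2 + k < W" using k W_def by simp
  have r1: "runs program B 1 s (s\<lparr>pc := 72\<rparr>)"
    using runs_JumpZero[of program s 14 80 B] code_at_program(7) pre(1,6,9) by simp
  let ?s1 = "s\<lparr>pc := 72\<rparr>"
  define s2 where "s2 = fold exec mark_code ?s1"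
  have vu: "(n * W + u) * W + 1 = vrow u + 1" unfolding vrow_def ..
  have bnds: "k \<le> B" "vrow v + 2 + k \<le> B" "n * W + u \<le> B" "(n * W + u) * W + 1 \<le> B"
    unfolding vu using row_bounds(1)[OF u] row_bounds(2)[OF u, of 1] row_bounds(2)[OF pre(8) km] W_def
    by simp_all
  have "reg ?s1 3 = W" "reg ?s1 7 = 1" "reg ?s1 9 = n * W" "reg ?s1 13 = vrow v + 2"
    "reg ?s1 14 = Suc k" "mem ?s1 (vrow v + 2 + k) = u" using pre mu by simp_all
  note mark = mark_exec[OF this bnds, folded s2_def, unfolded vu]
  have r2: "runs program B 7 ?s1 s2"
    using runs_block[OF _ straight_code(4) mark(1)] pre(1) code_at_program(8)
    unfolding s2_def by (simp add: code_lengths)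
  have pc2: "pc s2 = 79"
    unfolding s2_def using pc_fold_exec[OF straight_code(4), of ?s1] by (simp add: code_lengths)
  let ?s3 = "s2\<lparr>pc := 71\<rparr>"
  have r3: "runs program B 1 s2 ?s3"
    using runs_Jump[of program s2 71 B] code_at_program(9) pc2 runs_bounded[OF r2] by simp
  have ne: "vrow x + y \<noteq> vrow u + 1" if "y < W" "y \<noteq> 1" for x y
    using vrow_eq_iff[of y 1 x u] that W_def by auto
  have adj3: "adj_rep (mem s2) A"
    by (rule adj_rep_cong[OF pre(10)]) (use ne in \<open>simp add: mark(2)\<close>)
  have blk3: "blocked (mem s2) (insert u X)" unfolding mark(2) using blocked_mark[OF pre(11) u] by simp
  have low: "mem s2 x = mem s x" if "x < W" for x
    unfolding mark(2) using vrow_ge_W[OF u] that by simp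
  have "\<exists>s'. runs program B (9 * k + 1) ?s3 s' \<and> pc s' = 80 \<and> adj_rep (mem s') A \<and>
     blocked (mem s') (insert u X \<union> set (take k (A v))) \<and> (\<forall>x<W. mem s' x = mem ?s3 x) \<and>
     (\<forall>z. z \<notin> {14, 16} \<longrightarrow> reg s' z = reg ?s3 z)"
    by (rule Suc.IH) (use pre mark(3,4) adj3 blk3 runs_bounded[OF r2] in auto)
  then obtain s' where IH: "runs program B (9 * k + 1) ?s3 s'" "pc s' = 80" "adj_rep (mem s') A"
     "blocked (mem s') (insert u X \<union> set (take k (A v)))" "\<forall>x<W. mem s' x = mem s2 x"
     "\<forall>z. z \<notin> {14, 16} \<longrightarrow> reg s' z = reg s2 z" by auto
  have "runs program B (9 * Suc k + 1) s s'"
    using runs_trans[OF runs_trans[OF runs_trans[OF r1 r2] r3] IH(1)] by simp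
  moreover have "insert u X \<union> set (take k (A v)) = X \<union> set (take (Suc k) (A v))"
    using k by (auto simp: take_Suc_conv_app_nth u_def)
  ultimately show ?case using IH low mark(4) by (intro exI[of _ s']) auto
qed

text \<open>Vertices are decided in decreasing order: \<open>I\<close> is a maximal independent
  subset of those from \<open>r\<close> on, while the marks reach its neighbours below
  \<open>r\<close> as well. At \<open>r = 0\<close> it is maximal in the whole graph.\<close>

definition greedy_inv :: "nat \<Rightarrow> nat list \<Rightarrow> ram_state \<Rightarrow> bool" where
  "greedy_inv r I s \<longleftrightarrow> bounded B s \<and>
     reg s 0 = length I \<and> reg s 1 = 0 \<and> reg s 2 = r \<and> reg s 3 = W \<and> reg s 7 = 1 \<and> reg s 8 = 2 \<and>
     reg s 9 = n * W \<and>
     adj_rep (mem s) A \<and> blocked (mem s) (\<Union>p\<in>set I. set (A p)) \<and> (\<forall>k<length I. mem s k = I ! k) \<and>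
     r \<le> n \<and> distinct I \<and> set I \<subseteq> {r..<n} \<and> (\<forall>p\<in>set I. \<forall>p'\<in>set I. p' \<notin> set (A p)) \<and>
     (\<forall>v\<in>{r..<n}. v \<in> set I \<or> (\<exists>p\<in>set I. v \<in> set (A p)))"

lemma greedy_inv_pc [simp]: "greedy_inv r I (s\<lparr>pc := l\<rparr>) = greedy_inv r I s"
  by (simp add: greedy_inv_def)

lemma greedy_step:
  assumes inv: "greedy_inv (Suc v) I s" and pc: "pc s = 59"
  shows "\<exists>k s' I'. k \<le> 9 * length (A v) + 14 \<and> runs program B k s s' \<and> pc s' = 59 \<and> greedy_inv v I' s'"
proof -
  define X where "X = (\<Union>p\<in>set I. set (A p))"
  have regs: "reg s 0 = length I" "reg s 1 = 0" "reg s 2 = Suc v" "reg s 3 = W" "reg s 7 = 1"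
    "reg s 8 = 2" "reg s 9 = n * W"
    and bnd: "bounded B s" and adj: "adj_rep (mem s) A" and blk: "blocked (mem s) X"
    and out: "\<And>k. k < length I \<Longrightarrow> mem s k = I ! k" and v: "v < n" and dist: "distinct I"
    and sub: "set I \<subseteq> {Suc v..<n}" and indep: "\<forall>p\<in>set I. \<forall>p'\<in>set I. p' \<notin> set (A p)"
    and maxi: "\<forall>v\<in>{Suc v..<n}. v \<in> set I \<or> (\<exists>p\<in>set I. v \<in> set (A p))"
    using inv unfolding greedy_inv_def X_def by auto
  \<comment> \<open>The chosen vertices are distinct and above \<open>v\<close>, so the next output
    cell is still in row 0.\<close>
  have "length I \<le> n - Suc v"
    using card_mono[OF _ sub] distinct_card[OF dist] by simp
  then have lenI: "length I < n" using v by simp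
  have r1: "runs program B 1 s (s\<lparr>pc := 60\<rparr>)"
    using runs_JumpZero[of program s 2 81 B] code_at_program(5) pc bnd regs(3) by simp
  let ?s1 = "s\<lparr>pc := 60\<rparr>"
  define s2 where "s2 = fold exec pick_code ?s1"
  define b where "b = (if v \<in> X then 1 else 0 :: nat)"
  define d where "d = length (A v)"
  have md: "mem s (vrow v) = d" "d \<le> m" and mb: "mem s (vrow v + 1) = b"
    using adj blk v unfolding adj_rep_def blocked_def d_def b_def by auto
  have bnds: "length I + 1 \<le> B" "v \<le> B" "n * W + v \<le> B" "vrow v + 2 \<le> B" "d \<le> B"
    using row_bounds(1)[OF v] row_bounds(2)[OF v, of 2] row_bounds(2)[OF v, of "n"]
      row_bounds(2)[OF v, of m] lenI md W_def v by simp_all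
  have "reg ?s1 0 = length I" "reg ?s1 2 = Suc v" "reg ?s1 3 = W" "reg ?s1 7 = 1" "reg ?s1 8 = 2"
    "reg ?s1 9 = n * W" "(n * W + v) * W = vrow v" "mem ?s1 (vrow v) = d" "mem ?s1 (vrow v + 1) = b"
    using regs md mb by (simp_all add: vrow_def)
  note pick = pick_exec[OF this bnds, folded s2_def]
  have r2: "runs program B 11 ?s1 s2"
    using runs_block[OF _ straight_code(3) pick(1)] bnd code_at_program(6)
    unfolding s2_def by (simp add: code_lengths)
  have pc2: "pc s2 = 71"
    unfolding s2_def using pc_fold_exec[OF straight_code(3), of ?s1] by (simp add: code_lengths)
  have high: "mem s2 (vrow u + y) = mem s (vrow u + y)" if "u < n" for u y
    unfolding pick(2) using vrow_ge_W[OF that] lenI W_def by simp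
  have adj2: "adj_rep (mem s2) A" by (rule adj_rep_cong[OF adj]) (rule high)
  have blk2: "blocked (mem s2) X" by (rule blocked_cong[OF blk]) (rule high)
  \<comment> \<open>For a blocked vertex \<open>k\<close> is 0 and the mark loop ends at its first
    test.\<close>
  define k where "k = d * (1 - b)"
  have k: "k \<le> length (A v)" unfolding k_def d_def by (cases b) auto
  have "\<exists>s'. runs program B (9 * k + 1) s2 s' \<and> pc s' = 80 \<and> adj_rep (mem s') A \<and>
     blocked (mem s') (X \<union> set (take k (A v))) \<and> (\<forall>x<W. mem s' x = mem s2 x) \<and>
     (\<forall>z. z \<notin> {14, 16} \<longrightarrow> reg s' z = reg s2 z)"
    by (rule mark_loop_runs) (use pick regs k v pc2 adj2 blk2 runs_bounded[OF r2] in \<open>auto simp: k_def\<close>)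
  then obtain s3 where s3: "runs program B (9 * k + 1) s2 s3" "pc s3 = 80" "adj_rep (mem s3) A"
     "blocked (mem s3) (X \<union> set (take k (A v)))" "\<And>x. x < W \<Longrightarrow> mem s3 x = mem s2 x"
     "\<And>z. z \<notin> {14, 16} \<Longrightarrow> reg s3 z = reg s2 z" by blast
  have r4: "runs program B 1 s3 (s3\<lparr>pc := 59\<rparr>)"
    using runs_Jump[of program s3 59 B] code_at_program(10) s3(2) runs_bounded[OF s3(1)] by simp
  define I' where "I' = I @ (if v \<in> X then [] else [v])"
  have regs3: "reg s3 0 = length I'" "reg s3 1 = 0" "reg s3 2 = v" "reg s3 3 = W" "reg s3 7 = 1"
    "reg s3 8 = 2" "reg s3 9 = n * W"
    using s3(6) pick regs unfolding I'_def b_def by auto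
  have blocked': "blocked (mem s3) (\<Union>p\<in>set I'. set (A p))"
  proof -
    have "X \<union> set (take k (A v)) = (\<Union>p\<in>set I'. set (A p))"
      unfolding I'_def X_def k_def b_def d_def by auto
    then show ?thesis using s3(4) by simp
  qed
  have out': "mem s3 q = I' ! q" if "q < length I'" for q
  proof -
    have "q \<le> length I" using that unfolding I'_def by (auto split: if_splits)
    then have "mem s3 q = ((mem s)(length I := v)) q" using s3(5)[of q] lenI W_def pick(2) by simp
    then show ?thesis using that out unfolding I'_def
      by (auto simp: nth_append less_Suc_eq split: if_splits)
  qed
  have dist': "distinct I'" "set I' \<subseteq> {v..<n}" using dist sub v unfolding I'_def by auto
  have indep': "\<forall>p\<in>set I'. \<forall>p'\<in>set I'. p' \<notin> set (A p)"
  proof (cases "v \<in> X")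
    case True
    then show ?thesis using indep unfolding I'_def by simp
  next
    case False
    have "v \<notin> set (A p)" "p \<notin> set (A v)" if "p \<in> set I" for p
      using False that nbr_sym[of p v] v sub unfolding X_def by auto
    then show ?thesis using indep nbr_irrefl[OF v] unfolding I'_def by auto
  qed
  have maxi': "\<forall>u\<in>{v..<n}. u \<in> set I' \<or> (\<exists>p\<in>set I'. u \<in> set (A p))"
  proof
    fix u assume "u \<in> {v..<n}"
    then have "u = v \<or> u \<in> {Suc v..<n}" by auto
    then show "u \<in> set I' \<or> (\<exists>p\<in>set I'. u \<in> set (A p))"
      using maxi unfolding I'_def X_def by auto
  qed
  have "greedy_inv v I' (s3\<lparr>pc := 59\<rparr>)"
    unfolding greedy_inv_pc unfolding greedy_inv_def
    using runs_bounded[OF s3(1)] regs3 s3(3) blocked' out' v dist' indep' maxi' by simp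
  moreover have "runs program B (1 + 11 + (9 * k + 1) + 1) s (s3\<lparr>pc := 59\<rparr>)"
    using runs_trans[OF runs_trans[OF runs_trans[OF r1 r2] s3(1)] r4] .
  ultimately show ?thesis
    using k by (intro exI[of _ "1 + 11 + (9 * k + 1) + 1"] exI[of _ "s3\<lparr>pc := 59\<rparr>"] exI[of _ I']) simp
qed

lemma greedy_loop_runs:
  assumes "greedy_inv r I s" "pc s = 59"
  shows "\<exists>k s' I'. k \<le> 14 * r + 9 * (\<Sum>v<r. length (A v)) + 1 \<and> runs program B k s s' \<and>
    pc s' = 81 \<and> greedy_inv 0 I' s'"
  using assms
proof (induction r arbitrary: s I)
  case 0
  then have "bounded B s" "reg s 2 = 0" unfolding greedy_inv_def by auto
  with runs_JumpZero[of program s 2 81 B] code_at_program(5) 0(2)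
  have "runs program B 1 s (s\<lparr>pc := 81\<rparr>)" by simp
  then show ?case using 0 by (intro exI[of _ 1] exI[of _ "s\<lparr>pc := 81\<rparr>"] exI[of _ I]) simp
next
  case (Suc v)
  from greedy_step[OF Suc.prems] obtain k s1 I1 where
    k: "k \<le> 9 * length (A v) + 14" and r1: "runs program B k s s1" and 1: "pc s1 = 59" "greedy_inv v I1 s1"
    by blast
  from Suc.IH[OF 1(2,1)] obtain k' s' I' where
    k': "k' \<le> 14 * v + 9 * (\<Sum>v<v. length (A v)) + 1" and r2: "runs program B k' s1 s'"
    and fin: "pc s' = 81" "greedy_inv 0 I' s'"
    by blast
  have "k + k' \<le> 14 * Suc v + 9 * (\<Sum>v<Suc v. length (A v)) + 1" using k k' by simp
  then show ?case using runs_trans[OF r1 r2] fin by blast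
qed

end

section \<open>The input and the output\<close>

lemma length_triples: "length (concat (map (\<lambda>(i, j, t). [i, j, t]) es)) = 3 * length es"
  by (induction es) auto

lemma nth_triples:
  fixes es :: "('b \<times> 'b \<times> 'b) list"
  defines "xs \<equiv> concat (map (\<lambda>(i, j, t). [i, j, t]) es)"
  assumes "q < length es"
  shows "(xs ! (3 * q), xs ! (3 * q + 1), xs ! (3 * q + 2)) = es ! q"
  using assms(2) unfolding xs_def
proof (induction es arbitrary: q)
  case (Cons e es)
  then show ?case by (cases q; cases e) auto
qed simp

lemma presents_edges:
  assumes G: "temporal_graph G" and P: "presents vs es G"
  shows "distinct (map pair_time es)"
    and "(i, j, t) \<in> set es \<Longrightarrow>
      i < length vs \<and> j < length vs \<and> i \<noteq> j \<and> 1 \<le> t \<and> t \<le> lifetime G"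
    and "u < length vs \<Longrightarrow> v < length vs \<Longrightarrow>
      edge_times es u v = {t. {vs ! u, vs ! v} \<in> layer G t}"
proof -
  have dv: "distinct vs" and rng: "\<And>i j t. (i, j, t) \<in> set es \<Longrightarrow> i < length vs \<and> j < length vs"
    and de: "distinct (map (time_edge_of vs) es)" and te: "time_edge_of vs ` set es = tedges G"
    using P unfolding presents_def by auto
  \<comment> \<open>As the enumeration factors through index pairs, distinct time-edges have
    distinct index pairs with time.\<close>
  have factor: "time_edge_of vs = (\<lambda>(e, t). ((!) vs ` e, t)) \<circ> pair_time"
    by (auto simp: time_edge_of_def pair_time_def)
  show "distinct (map pair_time es)"
    using de unfolding factor by (metis distinct_map map_map)
  show "i < length vs \<and> j < length vs \<and> i \<noteq> j \<and> 1 \<le> t \<and> t \<le> lifetime G" if e: "(i, j, t) \<in> set es"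
  proof -
    have "({vs ! i, vs ! j}, t) \<in> tedges G"
      unfolding te[symmetric] using e by (force simp: time_edge_of_def)
    then have "card {vs ! i, vs ! j} = 2" "t \<in> {1..lifetime G}"
      using G unfolding temporal_graph_def by auto
    then show ?thesis using rng[OF e] by (cases "i = j") auto
  qed
  show "edge_times es u v = {t. {vs ! u, vs ! v} \<in> layer G t}" if uv: "u < length vs" "v < length vs"
  proof -
    have "{vs ! u, vs ! v} = {vs ! fst e, vs ! fst (snd e)} \<longleftrightarrow> {u, v} = {fst e, fst (snd e)}"
      if "e \<in> set es" for e
    proof -
      obtain i j t where e: "e = (i, j, t)" by (cases e)
      then show ?thesis
        using uv rng[of i j t] that dv by (simp add: doubleton_eq_iff nth_eq_iff_index_eq)
    qed
    then have "({u, v}, t) \<in> pair_time ` set es \<longleftrightarrow> ({vs ! u, vs ! v}, t) \<in> time_edge_of vs ` set es" for t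
      by (simp add: image_iff pair_time_def time_edge_of_def split_beta cong: bex_cong)
    then show ?thesis unfolding edge_times_def layer_def te by simp
  qed
qed

lemma conflict_iff_conflict_edges:
  assumes G: "temporal_graph G" and P: "presents vs es G" and \<Delta>: "1 \<le> \<Delta>" "\<Delta> \<le> lifetime G"
    and uv: "u < length vs" "v < length vs"
  shows "conflict \<Delta> es u v \<longleftrightarrow> {vs ! u, vs ! v} \<in> conflict_edges G \<Delta>"
proof -
  let ?T = "{t. {vs ! u, vs ! v} \<in> layer G t}"
  have sub: "?T \<subseteq> {1..lifetime G}" using G unfolding layer_def temporal_graph_def by auto
  have "(\<exists>a. {a..<a + \<Delta>} \<subseteq> ?T) \<longleftrightarrow> (\<exists>a\<in>{1..lifetime G - \<Delta> + 1}. {a..a + \<Delta> - 1} \<subseteq> ?T)"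
  proof
    assume "\<exists>a. {a..<a + \<Delta>} \<subseteq> ?T"
    then obtain a where a: "{a..<a + \<Delta>} \<subseteq> ?T" by blast
    have eq: "{a..a + \<Delta> - 1} = {a..<a + \<Delta>}" using \<Delta> by auto
    have "a \<in> {a..<a + \<Delta>}" "a + \<Delta> - 1 \<in> {a..<a + \<Delta>}" using \<Delta> by auto
    \<comment> \<open>The two ends of the window carry time-edges, which bounds its start from below
      and above.\<close>
    then have "a \<in> {1..lifetime G}" "a + \<Delta> - 1 \<in> {1..lifetime G}" using a sub by blast+
    then have "a \<in> {1..lifetime G - \<Delta> + 1}" using \<Delta> by auto
    then show "\<exists>a\<in>{1..lifetime G - \<Delta> + 1}. {a..a + \<Delta> - 1} \<subseteq> ?T"
      using a unfolding eq[symmetric] by blast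
  next
    assume "\<exists>a\<in>{1..lifetime G - \<Delta> + 1}. {a..a + \<Delta> - 1} \<subseteq> ?T"
    then obtain a where "{a..a + \<Delta> - 1} \<subseteq> ?T" by blast
    moreover have "{a..<a + \<Delta>} \<subseteq> {a..a + \<Delta> - 1}" using \<Delta> by auto
    ultimately show "\<exists>a. {a..<a + \<Delta>} \<subseteq> ?T" by blast
  qed
  then show ?thesis
    unfolding conflict_def presents_edges(3)[OF G P uv] conflict_edges_def by auto
qed

section \<open>The complete run and the approximation theorem\<close>

lemma (in edge_loop) program_runs:
  fixes s :: ram_state
  assumes s: "pc s = 0" "reg s 0 = 0" "reg s 1 = 0" "bounded B s"
    and inp: "mem s 0 = n" "mem s 1 = \<tau>" "mem s 2 = \<Delta>" "mem s 3 = m" "input_rep (mem s)"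
    and zero: "\<And>a. W \<le> a \<Longrightarrow> mem s a = 0"
  shows "\<exists>k s' I. k \<le> 64 * (n + (4 + 3 * m)) \<and> runs program B k s s' \<and> pc s' = 81 \<and>
    ram_output s' = I \<and> distinct I \<and> set I \<subseteq> {..<n} \<and>
    (\<forall>u\<in>set I. \<forall>v\<in>set I. \<not> conflict \<Delta> es u v) \<and>
    (\<forall>v<n. v \<in> set I \<or> (\<exists>u\<in>set I. conflict \<Delta> es u v))"
proof -
  have "n * W \<le> W * W" using W_def by (intro mult_right_mono) auto
  then have nW: "n * W \<le> B" using W_le_B by linarith
  define s1 where "s1 = fold exec setup_code s"
  note start = setup_exec[OF s(2,3) inp(1-4) W_def W_le_B(1) nW, folded s1_def]
  have r1: "runs program B 14 s s1"
    using runs_block[OF _ straight_code(1) start(1) s(4)] code_at_program(1) s(1)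
    unfolding s1_def by (simp add: code_lengths)
  have pc1: "pc s1 = 14"
    unfolding s1_def using pc_fold_exec[OF straight_code(1), of s] s(1) by (simp add: code_lengths)
  have no_times: "edge_times [] u v = {}" for u v unfolding edge_times_def by simp
  \<comment> \<open>Without time-edges all runs are empty, and their length 0 is what fresh memory
    holds.\<close>
  have "tables (mem s1) []"
    unfolding tables_def run_table_def no_times
  proof (intro allI impI)
    fix hi lo a b :: nat
    assume "hi < n" "lo < hi" and ab: "a < b \<and> b \<le> \<tau> + 1 \<and> a \<notin> {} \<and> b \<notin> {} \<and> {a<..<b} \<subseteq> {}"
    have b: "b = a + 1"
    proof (rule ccontr)
      assume "b \<noteq> a + 1"
      moreover have "a < b" using ab by blast
      ultimately have "a + 1 \<in> {a<..<b}" by simp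
      then show False using ab by blast
    qed
    have z: "mem s1 ((hi * W + lo) * W + x) = 0" for x
      unfolding start(12) by (rule zero[OF pair_ge_W[OF \<open>lo < hi\<close>]])
    show "mem s1 ((hi * W + lo) * W + (a + 1)) = b - a - 1 \<and>
      mem s1 ((hi * W + lo) * W + (b - 1)) = b - a - 1"
      unfolding z b by simp
  qed
  moreover have "mem s1 (vrow v + y) = 0" if "v < n" for v y
    unfolding start(12) using vrow_ge_W[OF that] by (intro zero) simp
  then have "mem s1 (vrow v) = 0" "mem s1 (vrow v + 1) = 0" if "v < n" for v
    using that by (metis add_0_right)+
  then have "adj_rep (mem s1) (\<lambda>_. [])" "blocked (mem s1) {}"
    unfolding adj_rep_def blocked_def by simp_all
  moreover have "adj_lists 0 (\<lambda>_. [])"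
    unfolding adj_lists_def conflict_def using \<Delta>(1) no_times by simp
  ultimately have "edge_inv 0 (\<lambda>_. []) s1"
    unfolding edge_inv_def using runs_bounded[OF r1] start inp(5) by simp
  from edge_loop_runs[OF this pc1] obtain A s2 where
    r2: "runs program B (45 * m + 1) s1 s2" and pc2: "pc s2 = 59" and inv2: "edge_inv m A s2"
    by auto
  have "adj_lists m A" using inv2 unfolding edge_inv_def by blast
  then have A: "\<And>v. v < n \<Longrightarrow> set (A v) = {u. u < n \<and> conflict \<Delta> es v u}"
    and Asum: "(\<Sum>v<n. length (A v)) \<le> 2 * m"
    unfolding adj_lists_def by (simp_all add: m_def)
  have irrefl: "\<not> conflict \<Delta> es v v" for v
  proof -
    have "edge_times es v v = {}"
      using edges unfolding edge_times_def pair_time_def by (auto simp: doubleton_eq_iff)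
    then show ?thesis unfolding conflict_def using \<Delta>(1) by auto
  qed
  interpret greedy_loop n \<tau> m W B A
    by unfold_locales (use B A irrefl conflict_commute in auto)
  have "greedy_inv n [] s2"
    unfolding greedy_inv_def using inv2 unfolding edge_inv_def by simp
  from greedy_loop_runs[OF this pc2] obtain k s3 I where
    k: "k \<le> 14 * n + 9 * (\<Sum>v<n. length (A v)) + 1" and r3: "runs program B k s2 s3"
    and pc3: "pc s3 = 81" and inv3: "greedy_inv 0 I s3"
    by blast
  have I: "reg s3 0 = length I" "reg s3 1 = 0" "\<forall>k<length I. mem s3 k = I ! k" "distinct I"
    "set I \<subseteq> {..<n}" "\<forall>p\<in>set I. \<forall>p'\<in>set I. p' \<notin> set (A p)"
    "\<forall>v<n. v \<in> set I \<or> (\<exists>p\<in>set I. v \<in> set (A p))"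
    using inv3 unfolding greedy_inv_def by auto
  have "ram_output s3 = I"
    unfolding ram_output_def using I(1-3) by (auto intro: nth_equalityI)
  moreover have "\<forall>u\<in>set I. \<forall>v\<in>set I. \<not> conflict \<Delta> es u v"
    using I(5,6) A by blast
  moreover have "\<forall>v<n. v \<in> set I \<or> (\<exists>u\<in>set I. conflict \<Delta> es u v)"
    using I(5,7) A by blast
  \<comment> \<open>At most \<open>2 * m\<close> list entries at 9 steps each give the share
    \<open>18 * m\<close> of the greedy phase.\<close>
  moreover have "14 + (45 * m + 1) + k \<le> 64 * (n + (4 + 3 * m))" using k Asum by simp
  ultimately show ?thesis
    using runs_trans[OF runs_trans[OF r1 r2] r3] pc3 I(4,5) by blast
qed

text \<open>The factor 8 from cubing \<open>2 * x\<close> is absorbed by two more powers of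
  \<open>x\<close>, so exponent 5 is reached and then raised to the shared constant.\<close>

lemma cube_le_power:
  assumes "4 \<le> (x::nat)" "w \<le> 2 * x"
  shows "w * w * w \<le> x ^ 64"
proof -
  have "w * w * w \<le> (2 * x) * (2 * x) * (2 * x)" using assms(2) by (intro mult_mono) auto
  also have "\<dots> = 8 * x ^ 3" by (simp add: power3_eq_cube)
  also have "\<dots> \<le> (x * x) * x ^ 3"
  proof (rule mult_right_mono)
    have "4 * 4 \<le> x * x" using assms(1) by (intro mult_mono) auto
    then show "8 \<le> x * x" by simp
  qed simp
  also have "\<dots> = x ^ 5" by (simp add: numeral_eq_Suc)
  also have "\<dots> \<le> x ^ 64" using assms(1) by (intro power_increasing) auto
  finally show ?thesis .
qed

theorem theorem14:
  "approximated_in_linear_time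
     (temporal_unit_interval_graph :: 'a temporal_graph \<Rightarrow> bool)
     (\<lambda>G \<Delta>. real ((lifetime G - \<Delta> + 1) * 2 ^ \<Delta>))"
  unfolding approximated_in_linear_time_def Let_def
proof (intro exI[of _ program] exI[of _ 64] allI impI)
  fix G :: "'a temporal_graph" and \<Delta> vs es
  assume G: "temporal_unit_interval_graph G" and window: "1 \<le> \<Delta>" "\<Delta> \<le> lifetime G"
    and P: "presents vs es G"
  have tg: "temporal_graph G" using G unfolding temporal_unit_interval_graph_def by blast
  define w where "w = input_words vs es G \<Delta>"
  define n m \<tau> where "n = length vs" and "m = length es" and "\<tau> = lifetime G"
  define X where "X = n + length w + Max (set w)"
  define W where "W = n + 3 * m + \<tau> + 6"
  have w: "w = [n, \<tau>, \<Delta>, m] @ concat (map (\<lambda>(i, j, t). [i, j, t]) es)"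
    unfolding w_def input_words_def n_def m_def \<tau>_def ..
  have lenw: "length w = 4 + 3 * m" unfolding w by (simp add: length_triples m_def)
  have Mx: "x \<le> Max (set w)" if "x \<in> set w" for x using that by simp
  have "\<tau> \<le> Max (set w)" by (rule Mx) (simp add: w)
  \<comment> \<open>\<open>W\<close> exceeds \<open>X\<close> by at most 2, and the four header
    words make \<open>X\<close> at least 4, hence \<open>W \<le> 2 * X\<close>.\<close>
  then have cube: "W * W * W \<le> X ^ 64"
    unfolding X_def W_def lenw by (intro cube_le_power) auto
  interpret edge_loop n \<tau> m W \<Delta> "X ^ 64" es
  proof unfold_locales
    show "W = n + 3 * m + \<tau> + 6" "m = length es" by (fact W_def m_def)+
    show "i < n \<and> j < n \<and> i \<noteq> j \<and> 1 \<le> t \<and> t \<le> \<tau>" if "(i, j, t) \<in> set es" for i j t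
      unfolding n_def \<tau>_def by (rule presents_edges(2)[OF tg P that])
    show "distinct (map pair_time es)" by (rule presents_edges(1)[OF tg P])
    show "1 \<le> \<Delta>" "\<Delta> \<le> \<tau>" using window unfolding \<tau>_def by simp_all
    show "W * W * W \<le> X ^ 64" by (rule cube)
  qed
  let ?s = "init_state w"
  have "Max (set w) \<le> X ^ 64"
  proof -
    have "Max (set w) \<le> X" unfolding X_def by simp
    also have "X \<le> X ^ 64" by (cases "X = 0") (auto intro: self_le_power)
    finally show ?thesis .
  qed
  then have "w ! a \<le> X ^ 64" if "a < length w" for a
    using le_trans[OF Mx[OF nth_mem[OF that]]] by blast
  then have bnd: "bounded (X ^ 64) ?s"
    unfolding bounded_def init_state_def by simp
  have mem_w: "mem ?s a = w ! a" if "a < length w" for a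
    using that unfolding init_state_def by simp
  have "input_rep (mem ?s)"
    unfolding input_rep_def
  proof (intro allI impI)
    fix q assume q: "q < m"
    have "mem ?s (4 + x) = concat (map (\<lambda>(i, j, t). [i, j, t]) es) ! x" if "x < 3 * m" for x
      using mem_w[of "4 + x"] that lenw unfolding w by simp
    then show "(mem ?s (4 + 3 * q), mem ?s (4 + 3 * q + 1), mem ?s (4 + 3 * q + 2)) = es ! q"
      unfolding add.assoc using nth_triples[of q es] q by (simp only: m_def)
  qed
  moreover have "mem ?s a = 0" if "W \<le> a" for a
    using that lenw unfolding init_state_def W_def by simp
  moreover have "mem ?s 0 = n" "mem ?s 1 = \<tau>" "mem ?s 2 = \<Delta>" "mem ?s 3 = m"
    unfolding init_state_def w by simp_all
  moreover have "pc ?s = 0" "reg ?s 0 = 0" "reg ?s 1 = 0" unfolding init_state_def by simp_all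
  ultimately obtain k s' I where k: "k \<le> 64 * (n + (4 + 3 * m))"
    and run: "runs program (X ^ 64) k ?s s'" and pc: "pc s' = 81" and out: "ram_output s' = I"
    and dist: "distinct I" and sub: "set I \<subseteq> {..<n}"
    and indep: "\<forall>u\<in>set I. \<forall>v\<in>set I. \<not> conflict \<Delta> es u v"
    and maxi: "\<forall>v<n. v \<in> set I \<or> (\<exists>u\<in>set I. conflict \<Delta> es u v)"
    using program_runs[OF _ _ _ bnd] by blast
  have "ram_run program w (64 * (n + length w)) (X ^ 64) I"
    unfolding ram_run_def
  proof (intro exI[of _ k] conjI)
    show "k \<le> 64 * (n + length w)" using k lenw by simp
    have s': "(step program ^^ k) ?s = s'" and
      b: "\<forall>i\<le>k. bounded (X ^ 64) ((step program ^^ i) ?s)"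
      using run unfolding runs_def by blast+
    show "halted program ((step program ^^ k) ?s)"
      unfolding s' halted_def using pc by (simp add: code_lengths)
    show "ram_output ((step program ^^ k) ?s) = I" unfolding s' by (rule out)
    show "\<forall>i\<le>k. \<forall>a. reg ((step program ^^ i) ?s) a \<le> X ^ 64 \<and> mem ((step program ^^ i) ?s) a \<le> X ^ 64"
      using b unfolding bounded_def by blast
  qed
  moreover define S where "S = (!) vs ` set I"
  have confl: "conflict \<Delta> es u v \<longleftrightarrow> {vs ! u, vs ! v} \<in> conflict_edges G \<Delta>" if "u < n" "v < n" for u v
    using conflict_iff_conflict_edges[OF tg P window] that unfolding n_def by blast
  have vs: "set vs = verts G" using P unfolding presents_def by blast
  have SV: "S \<subseteq> verts G" using sub unfolding S_def vs[symmetric] n_def by auto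
  have indepS: "independent_set (verts G) (conflict_edges G \<Delta>) S"
    using SV indep confl sub unfolding independent_set_def S_def by blast
  have maxS: "v \<in> S \<or> (\<exists>p\<in>S. {p, v} \<in> conflict_edges G \<Delta>)" if v: "v \<in> verts G" for v
  proof -
    obtain q where q: "q < n" "v = vs ! q" using v unfolding vs[symmetric] n_def by (metis in_set_conv_nth)
    show ?thesis using maxi[rule_format, OF q(1)] confl q sub unfolding S_def by blast
  qed
  have "max_independent G \<Delta> \<le> card S * ((lifetime G - \<Delta> + 1) * 2 ^ \<Delta>)"
    by (rule max_independent_le[OF G window SV maxS])
  then have "real (max_independent G \<Delta>) \<le> real (card S) * real ((lifetime G - \<Delta> + 1) * 2 ^ \<Delta>)"
    by (metis of_nat_le_iff of_nat_mult)
  then have "real (max_independent G \<Delta>) / real ((lifetime G - \<Delta> + 1) * 2 ^ \<Delta>) \<le> real (card S)"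
  proof (subst pos_divide_le_eq)
    have "0 < (lifetime G - \<Delta> + 1) * 2 ^ \<Delta>" by (intro mult_pos_pos) simp_all
    then show "0 < real ((lifetime G - \<Delta> + 1) * 2 ^ \<Delta>)" by (simp only: of_nat_0_less_iff)
  qed
  ultimately show "\<exists>xs. ram_run program (input_words vs es G \<Delta>)
           (64 * (length vs + length (input_words vs es G \<Delta>)))
           ((length vs + length (input_words vs es G \<Delta>) + Max (set (input_words vs es G \<Delta>))) ^ 64) xs \<and>
          distinct xs \<and> set xs \<subseteq> {..<length vs} \<and>
          independent_set (verts G) (conflict_edges G \<Delta>) ((!) vs ` set xs) \<and>
          real (max_independent G \<Delta>) / real ((lifetime G - \<Delta> + 1) * 2 ^ \<Delta>)
          \<le> real (card ((!) vs ` set xs))"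
    using dist sub indepS unfolding w_def n_def X_def S_def by blast
qed

end
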